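(* Let $1<p<\infty$ and let $\theta$ be an inner function in the upper half-plane. Then $K_\theta^p\subset H_\infty^+$ if and only if $$\lim_{\varepsilon\to 0^+}\ \inf\{|\theta(z)|:\ 0<\operatorname{Im} z<\varepsilon\}=1 .$$
   Context: $\mathbb{C}^+$ and $\mathbb{C}^-$ are the open upper and lower half-planes. $H_p^\pm=H^p(\mathbb{C}^\pm)$ are the Hardy spaces of the upper/lower half-plane, identified via boundary values with closed subspaces of $L_p=L^p(\mathbb{R})$, and $H_\infty^\pm=H^\infty(\mathbb{C}^\pm)$. An inner function is a function $\theta\in H_\infty^+$ with $|\theta|=1$ a.e. on $\mathbb{R}$. The model space is $K_\theta^p:=H_p^+\cap\theta H_p^-$. *)

theory Defs
  imports "HOL-Complex_Analysis.Complex_Analysis"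
begin

definition upper_halfplane :: "complex set" where
  "upper_halfplane = {z. Im z > 0}"

definition lower_halfplane :: "complex set" where
  "lower_halfplane = {z. Im z < 0}"

text \<open>
  In what follows \<open>\<Omega>\<close> is always one of the two half-planes. The spaces \<open>hardy_fun p \<Omega>\<close> and
  \<open>hardy_inf_fun \<Omega>\<close> consist of holomorphic functions on \<open>\<Omega>\<close>; values outside \<open>\<Omega>\<close> are irrelevant.
\<close>

definition hardy_fun :: "real \<Rightarrow> complex set \<Rightarrow> (complex \<Rightarrow> complex) set" where
  "hardy_fun p \<Omega> = {F. F holomorphic_on \<Omega> \<and>
     (SUP y\<in>{y. \<i> * of_real y \<in> \<Omega>}.
        \<integral>\<^sup>+ x. ennreal (norm (F (Complex x y)) powr p) \<partial>lborel) < \<infinity>}"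

definition hardy_inf_fun :: "complex set \<Rightarrow> (complex \<Rightarrow> complex) set" where
  "hardy_inf_fun \<Omega> = {F. F holomorphic_on \<Omega> \<and> bounded (F ` \<Omega>)}"

definition stolz_cone :: "complex set \<Rightarrow> real \<Rightarrow> real \<Rightarrow> complex set" where
  "stolz_cone \<Omega> x a = {z \<in> \<Omega>. \<bar>Re z - x\<bar> < a * \<bar>Im z\<bar>}"

text \<open>\<open>f\<close> is the nontangential boundary function of \<open>F\<close>, almost everywhere on the real line.\<close>

definition has_boundary_values ::
    "complex set \<Rightarrow> (complex \<Rightarrow> complex) \<Rightarrow> (real \<Rightarrow> complex) \<Rightarrow> bool" where
  "has_boundary_values \<Omega> F f \<longleftrightarrow>
     (AE x in lborel. \<forall>a>0. (F \<longlongrightarrow> f x) (at (of_real x) within stolz_cone \<Omega> x a))"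

text \<open>
  Elements of \<open>L\<^sub>p\<close> are represented by Borel functions, without passing to equivalence classes;
  all the sets of functions on the line below are closed under almost everywhere equality
  of Borel functions.
\<close>

definition Lp_space :: "real \<Rightarrow> (real \<Rightarrow> complex) set" where
  "Lp_space p = {f \<in> borel_measurable lborel. integrable lborel (\<lambda>x. norm (f x) powr p)}"

definition Linf_space :: "(real \<Rightarrow> complex) set" where
  "Linf_space = {f \<in> borel_measurable lborel. \<exists>C. AE x in lborel. norm (f x) \<le> C}"

definition hardy_space :: "real \<Rightarrow> complex set \<Rightarrow> (real \<Rightarrow> complex) set" where
  "hardy_space p \<Omega> = {f \<in> Lp_space p. \<exists>F \<in> hardy_fun p \<Omega>. has_boundary_values \<Omega> F f}"

definition hardy_inf_space :: "complex set \<Rightarrow> (real \<Rightarrow> complex) set" where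
  "hardy_inf_space \<Omega> = {f \<in> Linf_space. \<exists>F \<in> hardy_inf_fun \<Omega>. has_boundary_values \<Omega> F f}"

definition inner_function :: "(complex \<Rightarrow> complex) \<Rightarrow> bool" where
  "inner_function \<theta> \<longleftrightarrow> \<theta> \<in> hardy_inf_fun upper_halfplane \<and>
     (\<exists>t. has_boundary_values upper_halfplane \<theta> t \<and> (AE x in lborel. norm (t x) = 1))"

text \<open>
  The product of (the boundary function of) \<open>\<theta>\<close> with a set \<open>S\<close> of functions on the line. The
  boundary function \<open>t\<close> is determined by \<open>\<theta>\<close> up to a null set.
\<close>

definition boundary_mult ::
    "(complex \<Rightarrow> complex) \<Rightarrow> (real \<Rightarrow> complex) set \<Rightarrow> (real \<Rightarrow> complex) set" where
  "boundary_mult \<theta> S = {f \<in> borel_measurable lborel. \<exists>t. \<exists>g\<in>S.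
     has_boundary_values upper_halfplane \<theta> t \<and> (AE x in lborel. f x = t x * g x)}"

definition model_space :: "real \<Rightarrow> (complex \<Rightarrow> complex) \<Rightarrow> (real \<Rightarrow> complex) set" where
  "model_space p \<theta> =
     hardy_space p upper_halfplane \<inter> boundary_mult \<theta> (hardy_space p lower_halfplane)"

end

theory Submission
  imports Defs
begin

text \<open>
  Only a lower bound for \<open>|\<theta>|\<close> near the line matters. The infimum over the strip \<open>0 < Im z < \<epsilon>\<close> is at
  most 1, because \<open>|\<theta>|\<close> has vertical limits of modulus 1 almost everywhere. Hence it tends to 1 as soon as for each \<open>c < 1\<close>
  some strip satisfies \<open>|\<theta>| > c\<close>, and if it tends to 1, then \<open>|\<theta>| \<ge> 1/2\<close> on some strip.

  Suppose that \<open>|\<theta>| \<ge> 1/2\<close> on a strip, and let \<open>f = t g\<close> belong to the model space, with \<open>f\<close> and \<open>g\<close> the boundary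
  functions of \<open>F\<close> and \<open>G\<close> in the Hardy classes of the upper and the lower half-plane. By reflection \<open>\<theta>\<close>
  continues to the strip below the line as \<open>1 / cnj (\<theta> (cnj w))\<close>, so \<open>H w = G w / cnj (\<theta> (cnj w))\<close> is
  holomorphic there, uniformly in \<open>L\<^sub>p\<close> on horizontal lines, and has the boundary function \<open>f\<close>. Thus \<open>F\<close> and
  \<open>H\<close> are analytic continuations of each other across the line. Quantitatively (lemmas
  \<open>glue_across_line\<close> and \<open>glue_weighted_bound\<close>), Cauchy's formula on strips represents \<open>F\<close> near the line by
  integrals over one line in the upper and one in the lower half-plane, both at a positive distance, and this bounds
  \<open>F\<close>. At a positive distance from the line every function of the Hardy class is bounded. Two facts
  carry this. An \<open>L\<^sub>p\<close> bound with \<open>p > 1\<close> makes the functions on the lines uniformly integrable, so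
  that almost everywhere convergence to the boundary values improves to convergence in the mean. After division by
  \<open>(w - z)\<^sup>2\<close>, with \<open>z\<close> a point below the strip, everything is in \<open>L\<^sub>1\<close> on the lines, which is what Cauchy's formula
  on a strip needs.

  Conversely, suppose that \<open>|\<theta> (l n)| \<le> c < 1\<close> with \<open>y n = Im (l n)\<close> tending to 0. The reproducing
  kernels \<open>(1 - cnj (\<theta> (l n)) \<theta> z) / (z - cnj (l n))\<close> belong to the model space, have \<open>L\<^sub>p\<close> norm at most
  a constant times \<open>y n powr (1/p - 1)\<close>, and at \<open>l n\<close> have modulus at least \<open>(1 - c\<^sup>2) / (2 y n)\<close>. A closed
  graph argument would now finish the proof. A gliding hump makes it explicit: if \<open>y n\<close> decreases fast enough, the sum
  of the kernels with weights \<open>4\<^sup>-\<^sup>n y n powr (1 - 1/p)\<close> is in the model space but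
  unbounded along \<open>l n\<close>. The lower factor \<open>g\<close> of this function comes, by reflection, from the corresponding
  sum of difference quotients of \<open>\<theta>\<close>. Both sums are instances of \<open>pole_series\<close>. Finally, a function of the
  Hardy class and a bounded one with the same boundary function coincide
  (\<open>hardy_eq_if_boundary_values_eq\<close>), so the boundary function of the sum is not in \<open>H\<^sub>\<infinity>\<close>.
\<close>

section \<open>Cauchy's formula on horizontal strips\<close>

lemma has_contour_integral_linepath_same_Im_iff:
  assumes "a < b"
  shows "(f has_contour_integral I) (linepath (Complex a c) (Complex b c)) \<longleftrightarrow>
         ((\<lambda>x. f (Complex x c)) has_integral I) {a..b}"
proof -
  have *: "linepath (Complex a c) (Complex b c) x = linepath (of_real a) (of_real b) x + \<i> * of_real c" for x
    by (simp add: linepath_def complex_eq_iff algebra_simps)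
  have **: "Complex b c - Complex a c = of_real b - of_real a"
    by (simp add: complex_eq_iff)
  have "(f has_contour_integral I) (linepath (Complex a c) (Complex b c)) \<longleftrightarrow>
        ((\<lambda>w. f (w + \<i> * of_real c)) has_contour_integral I) (linepath (of_real a) (of_real b))"
    unfolding has_contour_integral_linepath * ** ..
  also have "\<dots> \<longleftrightarrow> ((\<lambda>x. f (of_real x + \<i> * of_real c)) has_integral I) {a..b}"
    using assms by (subst has_contour_integral_linepath_Reals_iff) auto
  also have "(\<lambda>x. f (of_real x + \<i> * of_real c)) = (\<lambda>x. f (Complex x c))"
    by (simp add: Complex_eq)
  finally show ?thesis .
qed

lemma has_contour_integral_rectpath_sides:
  assumes J: "(g has_contour_integral J) (rectpath (Complex x1 a) (Complex x2 b))"
    and less: "x1 < x2" "a < b"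
    and cont: "continuous_on (cbox (Complex x1 a) (Complex x2 b) - box (Complex x1 a) (Complex x2 b)) g"
  shows "J = integral {x1..x2} (\<lambda>x. g (Complex x a)) - integral {x1..x2} (\<lambda>x. g (Complex x b))
           + \<i> * (integral {a..b} (\<lambda>y. g (Complex x2 y)) - integral {a..b} (\<lambda>y. g (Complex x1 y)))"
proof -
  have h: "((\<lambda>x. g (Complex x c)) has_integral integral {x1..x2} (\<lambda>x. g (Complex x c))) {x1..x2}"
    if "c = a \<or> c = b" for c
  proof (intro integrable_integral integrable_continuous_interval)
    show "continuous_on {x1..x2} (\<lambda>x. g (Complex x c))"
      using that less by (intro continuous_on_compose2[OF cont] continuous_intros)
        (auto simp: in_cbox_complex_iff in_box_complex_iff)
  qed
  have v: "((\<lambda>y. g (Complex c y)) has_integral integral {a..b} (\<lambda>y. g (Complex c y))) {a..b}"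
    if "c = x1 \<or> c = x2" for c
  proof (intro integrable_integral integrable_continuous_interval)
    show "continuous_on {a..b} (\<lambda>y. g (Complex c y))"
      using that less by (intro continuous_on_compose2[OF cont] continuous_intros)
        (auto simp: in_cbox_complex_iff in_box_complex_iff)
  qed
  have H: "(g has_contour_integral integral {x1..x2} (\<lambda>x. g (Complex x c))) (linepath (Complex x1 c) (Complex x2 c))"
    if "c = a \<or> c = b" for c
    using h[OF that] less has_contour_integral_linepath_same_Im_iff by blast
  have V: "(g has_contour_integral \<i> * integral {a..b} (\<lambda>y. g (Complex c y))) (linepath (Complex c a) (Complex c b))"
    if "c = x1 \<or> c = x2" for c
    using v[OF that] less by (subst has_contour_integral_linepath_same_Re_iff[of _ c _ a b]) auto
  have H': "(g has_contour_integral - integral {x1..x2} (\<lambda>x. g (Complex x b))) (linepath (Complex x2 b) (Complex x1 b))"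
    using has_contour_integral_reversepath[OF _ H[of b]] by simp
  have V': "(g has_contour_integral - (\<i> * integral {a..b} (\<lambda>y. g (Complex x1 y)))) (linepath (Complex x1 b) (Complex x1 a))"
    using has_contour_integral_reversepath[OF _ V[of x1]] by simp
  have "(g has_contour_integral integral {x1..x2} (\<lambda>x. g (Complex x a)) +
         (\<i> * integral {a..b} (\<lambda>y. g (Complex x2 y)) + (- integral {x1..x2} (\<lambda>x. g (Complex x b))
          + - (\<i> * integral {a..b} (\<lambda>y. g (Complex x1 y))))))
     (rectpath (Complex x1 a) (Complex x2 b))"
    unfolding rectpath_def Let_def using H[of a] V[of x2] H' V'
    by (intro has_contour_integral_join valid_path_join) auto
  from has_contour_integral_unique[OF J this] show ?thesis
    by (simp add: algebra_simps)
qed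

text \<open>
  By Tonelli's theorem the mass of \<open>f\<close> on the vertical segment above \<open>x\<close> is an integrable function of \<open>x\<close>, and so it
  cannot stay above \<open>\<tau>\<close> on a set of infinite measure. This supplies vertical sides of rectangles whose
  contribution to a contour integral vanishes, without any pointwise decay of \<open>f\<close>.
\<close>
lemma exists_small_column:
  assumes cont: "continuous_on {w. a \<le> Im w \<and> Im w \<le> b} f" and ab: "a < b"
    and B: "\<And>y. y \<in> {a..b} \<Longrightarrow> (\<integral>\<^sup>+ x. ennreal (norm (f (Complex x y))) \<partial>lborel) \<le> ennreal B"
    and \<tau>: "0 < \<tau>"
    and X: "X \<in> sets lborel" "emeasure lborel X = \<infinity>"
  shows "\<exists>x\<in>X. (\<integral>\<^sup>+ y. ennreal (norm (f (Complex x y))) * indicator {a..b} y \<partial>lborel) \<le> ennreal \<tau>"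
proof (rule ccontr)
  define u where "u = (\<lambda>(x, y). ennreal (norm (f (Complex x y))) * indicator {a..b} y)"
  have "(\<lambda>q::real \<times> real. indicator {q. snd q \<in> {a..b}} q *\<^sub>R f (Complex (fst q) (snd q))) \<in> borel_measurable borel"
  proof (rule borel_measurable_continuous_on_indicator)
    show "{q::real \<times> real. snd q \<in> {a..b}} \<in> sets borel"
      by (intro borel_closed closed_Collect_conj closed_Collect_le continuous_intros
            | simp add: atLeastAtMost_def)+
    show "continuous_on {q::real \<times> real. snd q \<in> {a..b}} (\<lambda>q. f (Complex (fst q) (snd q)))"
      by (intro continuous_on_compose2[OF cont] continuous_intros) auto
  qed
  then have "(\<lambda>q. ennreal (norm (indicator {q. snd q \<in> {a..b}} q *\<^sub>R f (Complex (fst q) (snd q))))) \<in> borel_measurable (borel :: (real \<times> real) measure)"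
    by measurable
  also have "(\<lambda>q. ennreal (norm (indicator {q. snd q \<in> {a..b}} q *\<^sub>R f (Complex (fst q) (snd q))))) = u"
    by (auto simp: u_def fun_eq_iff split: split_indicator)
  finally have u[measurable]: "u \<in> borel_measurable (lborel \<Otimes>\<^sub>M lborel)"
    by (simp add: borel_prod[symmetric] cong: measurable_cong_sets)
  assume "\<not> ?thesis"
  then have *: "ennreal \<tau> \<le> (\<integral>\<^sup>+ y. u (x, y) \<partial>lborel)" if "x \<in> X" for x
    using that by (fastforce simp: u_def)
  have "\<infinity> = (\<integral>\<^sup>+ x. ennreal \<tau> * indicator X x \<partial>lborel)"
    using \<tau> X by (subst nn_integral_cmult_indicator) (auto simp: ennreal_mult_top)
  also have "\<dots> \<le> (\<integral>\<^sup>+ x. (\<integral>\<^sup>+ y. u (x, y) \<partial>lborel) \<partial>lborel)"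
    using * by (intro nn_integral_mono) (auto split: split_indicator)
  also have "\<dots> = (\<integral>\<^sup>+ y. (\<integral>\<^sup>+ x. u (x, y) \<partial>lborel) \<partial>lborel)"
    using lborel_pair.Fubini'[of "\<lambda>x y. u (x, y)"] by simp
  also have "\<dots> \<le> (\<integral>\<^sup>+ y. ennreal B * indicator {a..b} y \<partial>lborel)"
    using B by (intro nn_integral_mono) (auto simp: u_def split: split_indicator)
  also have "\<dots> = ennreal B * ennreal (b - a)"
    using ab by (subst nn_integral_cmult_indicator) auto
  also have "\<dots> < \<infinity>"
    by (simp add: ennreal_mult_less_top)
  finally show False by simp
qed

text \<open>
  On a line that avoids \<open>\<zeta>\<close> the Cauchy kernel is bounded by the reciprocal of the distance of \<open>\<zeta>\<close> to that line.
\<close>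
lemma integrable_line_kernel:
  assumes cont: "continuous_on {w. Im w = c} f"
    and B: "(\<integral>\<^sup>+ x. ennreal (norm (f (Complex x c))) \<partial>lborel) \<le> ennreal B"
    and \<zeta>: "Im \<zeta> \<noteq> c"
  shows "integrable lborel (\<lambda>x. f (Complex x c))"
    and "integrable lborel (\<lambda>x. f (Complex x c) / (Complex x c - \<zeta>))"
    and "norm (LINT x|lborel. f (Complex x c) / (Complex x c - \<zeta>)) \<le> max 0 B / \<bar>Im \<zeta> - c\<bar>"
proof -
  have "continuous_on UNIV (\<lambda>x. f (Complex x c))"
    by (intro continuous_on_compose2[OF cont] continuous_intros) auto
  then have [measurable]: "(\<lambda>x. f (Complex x c)) \<in> borel_measurable borel"
    by (rule borel_measurable_continuous_onI)
  have "continuous_on UNIV (\<lambda>x. f (Complex x c) / (Complex x c - \<zeta>))"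
    using \<zeta> by (intro continuous_intros continuous_on_compose2[OF cont]) (auto simp: complex_eq_iff)
  then have [measurable]: "(\<lambda>x. f (Complex x c) / (Complex x c - \<zeta>)) \<in> borel_measurable borel"
    by (rule borel_measurable_continuous_onI)
  show fint: "integrable lborel (\<lambda>x. f (Complex x c))"
    using B by (intro integrableI_bounded) (auto simp: top_unique less_top[symmetric])
  then have fint': "integrable lborel (\<lambda>x. norm (f (Complex x c)) / \<bar>Im \<zeta> - c\<bar>)"
    by simp
  have gle: "norm (f (Complex x c) / (Complex x c - \<zeta>)) \<le> norm (f (Complex x c)) / \<bar>Im \<zeta> - c\<bar>" for x
  proof -
    have "\<bar>Im \<zeta> - c\<bar> \<le> norm (Complex x c - \<zeta>)"
      using abs_Im_le_cmod[of "Complex x c - \<zeta>"] by simp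
    then show ?thesis
      using \<zeta> unfolding norm_divide by (intro divide_left_mono mult_pos_pos) auto
  qed
  show gint: "integrable lborel (\<lambda>x. f (Complex x c) / (Complex x c - \<zeta>))"
    by (rule Bochner_Integration.integrable_bound[OF fint']) (use gle in \<open>auto intro: order_trans\<close>)
  have "ennreal (LINT x|lborel. norm (f (Complex x c))) \<le> ennreal (max 0 B)"
    using fint B by (subst nn_integral_eq_integral[symmetric]) (auto intro: order_trans ennreal_leI)
  then have "(LINT x|lborel. norm (f (Complex x c))) \<le> max 0 B"
    by (subst (asm) ennreal_le_iff) auto
  moreover have "norm (LINT x|lborel. f (Complex x c) / (Complex x c - \<zeta>)) \<le> (LINT x|lborel. norm (f (Complex x c)) / \<bar>Im \<zeta> - c\<bar>)"
    by (rule Bochner_Integration.integral_norm_bound_integral[OF gint fint' gle])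
  ultimately show "norm (LINT x|lborel. f (Complex x c) / (Complex x c - \<zeta>)) \<le> max 0 B / \<bar>Im \<zeta> - c\<bar>"
    by (simp add: divide_right_mono order_trans)
qed

text \<open>
  The common limit argument of the two Cauchy theorems below: rectangles are widened to the whole strip along the columns
  of \<open>exists_small_column\<close>. The value \<open>J\<close> on rectangles is left open, since it is \<open>0\<close> or \<open>2 \<pi> \<i> f \<zeta>\<close> according to
  the position of \<open>\<zeta>\<close>.
\<close>
lemma strip_line_integrals:
  fixes f :: "complex \<Rightarrow> complex" and \<zeta> :: complex
  defines "g \<equiv> (\<lambda>w. f w / (w - \<zeta>))"
  assumes cont: "continuous_on {w. a \<le> Im w \<and> Im w \<le> b} f" and ab: "a < b"
    and B: "\<And>y. y \<in> {a..b} \<Longrightarrow> (\<integral>\<^sup>+ x. ennreal (norm (f (Complex x y))) \<partial>lborel) \<le> ennreal B"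
    and \<zeta>: "Im \<zeta> \<noteq> a" "Im \<zeta> \<noteq> b"
    and J: "\<And>x1 x2. x1 < Re \<zeta> \<Longrightarrow> Re \<zeta> < x2 \<Longrightarrow>
              (g has_contour_integral J) (rectpath (Complex x1 a) (Complex x2 b))"
  shows "(LINT x|lborel. g (Complex x a)) - (LINT x|lborel. g (Complex x b)) = J"
proof -
  define \<psi> where "\<psi> = (\<lambda>x. \<integral>\<^sup>+ y. ennreal (norm (f (Complex x y))) * indicator {a..b} y \<partial>lborel)"
  have inf1: "emeasure lborel {c<..} = \<infinity>" and inf2: "emeasure lborel {..<c} = \<infinity>" for c :: real
  proof -
    have "ennreal (real n) \<le> emeasure lborel {c<..}" "ennreal (real n) \<le> emeasure lborel {..<c}" for n
    proof -
      have "{c<..c + real n} \<subseteq> {c<..}" "{c - real n..<c} \<subseteq> {..<c}" by auto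
      from this[THEN emeasure_mono[of _ _ lborel]]
      show "ennreal (real n) \<le> emeasure lborel {c<..}" "ennreal (real n) \<le> emeasure lborel {..<c}" by auto
    qed
    then show "emeasure lborel {c<..} = \<infinity>" "emeasure lborel {..<c} = \<infinity>"
      by (metis ennreal_Ex_less_of_nat ennreal_of_nat_eq_real_of_nat infinity_ennreal_def leD less_top)+
  qed
  have "\<exists>x. x > \<bar>Re \<zeta>\<bar> + 1 + real n \<and> \<psi> x \<le> ennreal (1 / real (Suc n))"
    and "\<exists>x. x < - \<bar>Re \<zeta>\<bar> - 1 - real n \<and> \<psi> x \<le> ennreal (1 / real (Suc n))" for n
    using exists_small_column[OF cont ab B, of "1 / real (Suc n)" "{\<bar>Re \<zeta>\<bar> + 1 + real n<..}"]
      exists_small_column[OF cont ab B, of "1 / real (Suc n)" "{..<- \<bar>Re \<zeta>\<bar> - 1 - real n}"] inf1 inf2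
    by (auto simp: \<psi>_def)
  then obtain X1 X2 where X2: "\<And>n. X2 n > \<bar>Re \<zeta>\<bar> + 1 + real n" "\<And>n. \<psi> (X2 n) \<le> ennreal (1 / real (Suc n))"
    and X1: "\<And>n. X1 n < - \<bar>Re \<zeta>\<bar> - 1 - real n" "\<And>n. \<psi> (X1 n) \<le> ennreal (1 / real (Suc n))"
    by metis
  have lt: "X1 n < Re \<zeta> - 1" "Re \<zeta> + 1 < X2 n" "X1 n < X2 n" for n
    using X1(1)[of n] X2(1)[of n] by auto
  have gcont: "continuous_on ({w. a \<le> Im w \<and> Im w \<le> b} - {\<zeta>}) g"
    unfolding g_def by (intro continuous_intros continuous_on_subset[OF cont]) auto
  \<comment> \<open>The kernel is bounded by the reciprocal distance to \<open>\<zeta>\<close> on the two lines, so dominated convergence applies.\<close>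
  have line: "(\<lambda>n. integral {X1 n..X2 n} (\<lambda>x. g (Complex x c))) \<longlonglongrightarrow> (LINT x|lborel. g (Complex x c))"
    if c: "c = a \<or> c = b" for c
  proof -
    have gint: "integrable lborel (\<lambda>x. g (Complex x c))"
      unfolding g_def
      using c ab \<zeta> by (intro integrable_line_kernel(2)[OF _ B[of c]] continuous_on_subset[OF cont]) auto
    have eq: "integral {X1 n..X2 n} (\<lambda>x. g (Complex x c)) = (LINT x|lborel. indicator {X1 n..X2 n} x *\<^sub>R g (Complex x c))" for n
    proof -
      have "set_integrable lborel {X1 n..X2 n} (\<lambda>x. g (Complex x c))"
        using gint by (auto simp: set_integrable_def intro: integrable_mult_indicator)
      then show ?thesis
        using set_borel_integral_eq_integral(2)[of "{X1 n..X2 n}" "\<lambda>x. g (Complex x c)"]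
        by (simp add: set_lebesgue_integral_def)
    qed
    show ?thesis unfolding eq
    proof (rule integral_dominated_convergence[where w = "\<lambda>x. norm (g (Complex x c))"])
      show "AE x in lborel. (\<lambda>n. indicat_real {X1 n..X2 n} x *\<^sub>R g (Complex x c)) \<longlonglongrightarrow> g (Complex x c)"
      proof (rule AE_I2)
        fix x :: real
        have "\<forall>\<^sub>F n in sequentially. indicat_real {X1 n..X2 n} x *\<^sub>R g (Complex x c) = g (Complex x c)"
          using eventually_ge_at_top[of "nat \<lceil>\<bar>x\<bar>\<rceil>"]
        proof eventually_elim
          case (elim n)
          then have "\<bar>x\<bar> \<le> real n" by linarith
          then show ?case using X1(1)[of n] X2(1)[of n] by (auto split: split_indicator)
        qed
        then show "(\<lambda>n. indicat_real {X1 n..X2 n} x *\<^sub>R g (Complex x c)) \<longlonglongrightarrow> g (Complex x c)"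
          by (rule tendsto_eventually)
      qed
    qed (use gint in \<open>auto split: split_indicator\<close>)
  qed
  \<comment> \<open>The columns keep distance 1 from \<open>\<zeta>\<close>, so the mass of \<open>f\<close> on a column dominates the integral of \<open>g\<close> there.\<close>
  have side: "(\<lambda>n. integral {a..b} (\<lambda>y. g (Complex (X n) y))) \<longlonglongrightarrow> 0"
    if X: "\<And>n. 1 \<le> \<bar>X n - Re \<zeta>\<bar>" "\<And>n. \<psi> (X n) \<le> ennreal (1 / real (Suc n))" for X
  proof (rule Lim_null_comparison)
    show "(\<lambda>n. 1 / real (Suc n)) \<longlonglongrightarrow> 0"
      using LIMSEQ_inverse_real_of_nat by (simp add: inverse_eq_divide)
    show "\<forall>\<^sub>F n in sequentially. norm (integral {a..b} (\<lambda>y. g (Complex (X n) y))) \<le> 1 / real (Suc n)"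
    proof (rule always_eventually, rule allI)
      fix n
      have contn: "continuous_on {a..b} (\<lambda>y. g (Complex (X n) y))"
        using X(1)[of n] by (intro continuous_on_compose2[OF gcont] continuous_intros) (auto simp: complex_eq_iff)
      have int: "set_integrable lborel {a..b} (\<lambda>y. g (Complex (X n) y))"
        by (rule borel_integrable_atLeastAtMost') (rule contn)
      have "ennreal (norm (integral {a..b} (\<lambda>y. g (Complex (X n) y))))
          = ennreal (norm (LINT y|lborel. indicator {a..b} y *\<^sub>R g (Complex (X n) y)))"
        using set_borel_integral_eq_integral(2)[OF int] by (simp add: set_lebesgue_integral_def)
      also have "\<dots> \<le> (\<integral>\<^sup>+ y. ennreal (norm (indicator {a..b} y *\<^sub>R g (Complex (X n) y))) \<partial>lborel)"
        using int by (intro integral_norm_bound_ennreal) (simp add: set_integrable_def)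
      also have "\<dots> \<le> \<psi> (X n)"
        unfolding \<psi>_def
      proof (intro nn_integral_mono)
        fix y
        have "1 \<le> norm (Complex (X n) y - \<zeta>)"
          using X(1)[of n] abs_Re_le_cmod[of "Complex (X n) y - \<zeta>"] by simp
        then have "norm (g (Complex (X n) y)) \<le> norm (f (Complex (X n) y))"
          unfolding g_def norm_divide
          using divide_left_mono[of 1 "norm (Complex (X n) y - \<zeta>)" "norm (f (Complex (X n) y))"]
          by (cases "Complex (X n) y = \<zeta>") auto
        then show "ennreal (norm (indicator {a..b} y *\<^sub>R g (Complex (X n) y)))
          \<le> ennreal (norm (f (Complex (X n) y))) * indicator {a..b} y"
          by (auto split: split_indicator intro: ennreal_leI)
      qed
      also have "\<dots> \<le> ennreal (1 / real (Suc n))" by (rule X)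
      finally show "norm (integral {a..b} (\<lambda>y. g (Complex (X n) y))) \<le> 1 / real (Suc n)"
        by (subst (asm) ennreal_le_iff) auto
    qed
  qed
  define R where "R = (\<lambda>n. integral {X1 n..X2 n} (\<lambda>x. g (Complex x a)) - integral {X1 n..X2 n} (\<lambda>x. g (Complex x b))
           + \<i> * (integral {a..b} (\<lambda>y. g (Complex (X2 n) y)) - integral {a..b} (\<lambda>y. g (Complex (X1 n) y))))"
  have "J = R n" for n
    unfolding R_def
  proof (rule has_contour_integral_rectpath_sides)
    show "(g has_contour_integral J) (rectpath (Complex (X1 n) a) (Complex (X2 n) b))"
      using lt[of n] by (intro J) auto
    show "continuous_on (cbox (Complex (X1 n) a) (Complex (X2 n) b) - box (Complex (X1 n) a) (Complex (X2 n) b)) g"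
      using lt[of n] \<zeta> by (intro continuous_on_subset[OF gcont]) (auto simp: in_cbox_complex_iff in_box_complex_iff)
  qed (use lt ab in auto)
  then have "R \<longlonglongrightarrow> J" by (auto intro: tendsto_eventually)
  moreover have "R \<longlonglongrightarrow> (LINT x|lborel. g (Complex x a)) - (LINT x|lborel. g (Complex x b)) + \<i> * (0 - 0)"
    unfolding R_def
  proof (intro tendsto_intros line side)
    show "1 \<le> \<bar>X2 n - Re \<zeta>\<bar>" "1 \<le> \<bar>X1 n - Re \<zeta>\<bar>" for n
      using lt[of n] by auto
  qed (use X1 X2 in auto)
  ultimately show ?thesis
    using LIMSEQ_unique by fastforce
qed

lemma strip_cauchy_formula:
  assumes hol: "f holomorphic_on {w. \<alpha> < Im w \<and> Im w < \<beta>}" and ab: "\<alpha> < a" "a < Im \<zeta>" "Im \<zeta> < b" "b < \<beta>"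
    and B: "\<And>y. y \<in> {a..b} \<Longrightarrow> (\<integral>\<^sup>+ x. ennreal (norm (f (Complex x y))) \<partial>lborel) \<le> ennreal B"
  shows "(LINT x|lborel. f (Complex x a) / (Complex x a - \<zeta>)) - (LINT x|lborel. f (Complex x b) / (Complex x b - \<zeta>))
     = 2 * pi * \<i> * f \<zeta>"
proof (rule strip_line_integrals[OF _ _ B])
  let ?S = "{w. \<alpha> < Im w \<and> Im w < \<beta>}"
  have S: "?S = {w. Im w > \<alpha>} \<inter> {w. Im w < \<beta>}" by auto
  have "convex ?S" "open ?S"
    unfolding S by (intro convex_Int convex_halfspace_Im_gt convex_halfspace_Im_lt open_Int open_halfspace_Im_gt open_halfspace_Im_lt)+
  fix x1 x2 assume x: "x1 < Re \<zeta>" "Re \<zeta> < x2"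
  have box: "\<zeta> \<in> box (Complex x1 a) (Complex x2 b)"
    using x ab by (simp add: in_box_complex_iff)
  have "((\<lambda>w. f w / (w - \<zeta>)) has_contour_integral 2 * pi * \<i> * winding_number (rectpath (Complex x1 a) (Complex x2 b)) \<zeta> * f \<zeta>)
          (rectpath (Complex x1 a) (Complex x2 b))"
  proof (rule Cauchy_integral_formula_convex_simple[OF \<open>convex ?S\<close> hol])
    show "\<zeta> \<in> interior ?S"
      using ab \<open>open ?S\<close> by (simp add: interior_open)
    show "path_image (rectpath (Complex x1 a) (Complex x2 b)) \<subseteq> ?S - {\<zeta>}"
      using box x ab by (subst path_image_rectpath_cbox_minus_box) (auto simp: in_cbox_complex_iff)
  qed auto
  then show "((\<lambda>w. f w / (w - \<zeta>)) has_contour_integral 2 * pi * \<i> * f \<zeta>) (rectpath (Complex x1 a) (Complex x2 b))"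
    using winding_number_rectpath[OF box] by simp
qed (use ab in \<open>auto intro!: continuous_on_subset[OF holomorphic_on_imp_continuous_on[OF hol]]\<close>)

lemma strip_cauchy_theorem:
  assumes hol: "f holomorphic_on {w. \<alpha> < Im w \<and> Im w < \<beta>}" and ab: "\<alpha> < a" "a < b" "b < \<beta>"
    and \<zeta>: "\<beta> \<le> Im \<zeta>"
    and B: "\<And>y. y \<in> {a..b} \<Longrightarrow> (\<integral>\<^sup>+ x. ennreal (norm (f (Complex x y))) \<partial>lborel) \<le> ennreal B"
  shows "(LINT x|lborel. f (Complex x a) / (Complex x a - \<zeta>)) = (LINT x|lborel. f (Complex x b) / (Complex x b - \<zeta>))"
proof -
  let ?S = "{w. \<alpha> < Im w \<and> Im w < \<beta>}"
  have S: "?S = {w. Im w > \<alpha>} \<inter> {w. Im w < \<beta>}" by auto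
  have "convex ?S"
    unfolding S by (intro convex_Int convex_halfspace_Im_gt convex_halfspace_Im_lt)
  have "(LINT x|lborel. f (Complex x a) / (Complex x a - \<zeta>)) - (LINT x|lborel. f (Complex x b) / (Complex x b - \<zeta>)) = 0"
  proof (rule strip_line_integrals[OF _ _ B])
    fix x1 x2 assume x: "x1 < Re \<zeta>" "Re \<zeta> < x2"
    show "((\<lambda>w. f w / (w - \<zeta>)) has_contour_integral 0) (rectpath (Complex x1 a) (Complex x2 b))"
    proof (rule Cauchy_theorem_convex_simple[OF _ \<open>convex ?S\<close>])
      show "(\<lambda>w. f w / (w - \<zeta>)) holomorphic_on ?S"
        using \<zeta> by (intro holomorphic_intros hol) auto
      show "path_image (rectpath (Complex x1 a) (Complex x2 b)) \<subseteq> ?S"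
        using x ab by (subst path_image_rectpath_cbox_minus_box) (auto simp: in_cbox_complex_iff)
    qed auto
  qed (use ab \<zeta> in \<open>auto intro!: continuous_on_subset[OF holomorphic_on_imp_continuous_on[OF hol]]\<close>)
  then show ?thesis by simp
qed

section \<open>Gluing across the real line\<close>

text \<open>
  For \<open>\<zeta>\<close> above the line, Cauchy's formula for \<open>f\<close> on \<open>\<eta> n \<le> Im w \<le> b\<close> and Cauchy's theorem for \<open>h\<close> on
  \<open>a \<le> Im w \<le> - \<eta> n\<close> are added. The integrals over the two inner lines approach each other because \<open>f\<close>
  and \<open>h\<close> do so in the mean, and only the outer lines remain. With \<open>h = 0\<close> this also gives uniqueness.
\<close>
lemma glue_across_line:
  assumes f: "f holomorphic_on {w. 0 < Im w \<and> Im w < \<beta>}" and h: "h holomorphic_on {w. \<alpha> < Im w \<and> Im w < 0}"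
    and Bf: "\<And>y. 0 < y \<Longrightarrow> y < \<beta> \<Longrightarrow> (\<integral>\<^sup>+ x. ennreal (norm (f (Complex x y))) \<partial>lborel) \<le> ennreal B"
    and Bh: "\<And>y. \<alpha> < y \<Longrightarrow> y < 0 \<Longrightarrow> (\<integral>\<^sup>+ x. ennreal (norm (h (Complex x y))) \<partial>lborel) \<le> ennreal B"
    and \<eta>: "\<And>n. 0 < \<eta> n" "\<eta> \<longlonglongrightarrow> 0"
    and lim: "(\<lambda>n. \<integral>\<^sup>+ x. ennreal (norm (f (Complex x (\<eta> n)) - h (Complex x (- \<eta> n)))) \<partial>lborel) \<longlonglongrightarrow> 0"
    and \<zeta>: "0 < Im \<zeta>" "Im \<zeta> < b" "b < \<beta>" "\<alpha> < a" "a < 0"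
  shows "2 * pi * \<i> * f \<zeta> = (LINT x|lborel. h (Complex x a) / (Complex x a - \<zeta>))
           - (LINT x|lborel. f (Complex x b) / (Complex x b - \<zeta>))"
proof -
  define U where "U = (\<lambda>y. LINT x|lborel. f (Complex x y) / (Complex x y - \<zeta>))"
  define V where "V = (\<lambda>y. LINT x|lborel. h (Complex x y) / (Complex x y - \<zeta>))"
  define B' where "B' = max 0 B"
  define r where "r = Im \<zeta>"
  have r: "0 < r" using \<zeta> by (simp add: r_def)
  \<comment> \<open>For \<open>y < e\<close> the inner lines lie between the outer ones and keep distance \<open>r / 2\<close> from \<open>\<zeta>\<close>.\<close>
  define e where "e = min (r / 2) (- a / 2)"
  have e: "0 < e" using \<zeta> r by (simp add: e_def)
  have contf: "continuous_on {w. Im w = y} f" if "0 < y" "y < \<beta>" for y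
    using that by (intro continuous_on_subset[OF holomorphic_on_imp_continuous_on[OF f]]) auto
  have conth: "continuous_on {w. Im w = y} h" if "\<alpha> < y" "y < 0" for y
    using that by (intro continuous_on_subset[OF holomorphic_on_imp_continuous_on[OF h]]) auto
  have id: "2 * pi * \<i> * f \<zeta> - (V a - U b) = U y - V (- y)" if "0 < y" "y < e" for y
  proof -
    have "U y - U b = 2 * pi * \<i> * f \<zeta>"
      unfolding U_def using that \<zeta> by (intro strip_cauchy_formula[OF f, where B = B] Bf) (auto simp: e_def r_def)
    moreover have "V a = V (- y)"
      unfolding V_def using that \<zeta> by (intro strip_cauchy_theorem[OF h, where B = B] Bh) (auto simp: e_def r_def)
    ultimately show ?thesis by (simp add: algebra_simps)
  qed
  have bound: "ennreal (norm (U y - V (- y))) \<le>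
      ennreal (2 / r) * (\<integral>\<^sup>+ x. ennreal (norm (f (Complex x y) - h (Complex x (- y)))) \<partial>lborel)
      + ennreal (4 * y / r\<^sup>2 * B')" if y: "0 < y" "y < e" for y
  proof -
    have yb: "y < \<beta>" "\<alpha> < - y" "Im \<zeta> \<noteq> y" "Im \<zeta> \<noteq> - y"
      using y \<zeta> by (auto simp: e_def r_def)
    note intU = integrable_line_kernel[OF contf Bf, of y \<zeta>]
    note intV = integrable_line_kernel[OF conth Bh, of "- y" \<zeta>]
    have [measurable]: "(\<lambda>x. f (Complex x y)) \<in> borel_measurable lborel" "(\<lambda>x. h (Complex x (-y))) \<in> borel_measurable lborel"
      using intU(1) intV(1) y yb by auto
    let ?d = "\<lambda>x. f (Complex x y) / (Complex x y - \<zeta>) - h (Complex x (- y)) / (Complex x (- y) - \<zeta>)"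
    have "U y - V (- y) = (LINT x|lborel. ?d x)"
      unfolding U_def V_def using y yb
      by (intro Bochner_Integration.integral_diff[symmetric] intU intV) auto
    then have "ennreal (norm (U y - V (- y))) \<le> (\<integral>\<^sup>+ x. ennreal (norm (?d x)) \<partial>lborel)"
      using y yb by (auto intro!: integral_norm_bound_ennreal Bochner_Integration.integrable_diff intU intV)
    also have "\<dots> \<le> (\<integral>\<^sup>+ x. ennreal (2 / r) * ennreal (norm (f (Complex x y) - h (Complex x (- y))))
         + ennreal (4 * y / r\<^sup>2) * ennreal (norm (h (Complex x (- y)))) \<partial>lborel)"
    proof (rule nn_integral_mono)
      fix x
      define A A' where "A = Complex x y - \<zeta>" and "A' = Complex x (- y) - \<zeta>"
      have A: "r / 2 \<le> norm A"
        using abs_Im_le_cmod[of A] y by (auto simp: A_def e_def r_def)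
      have A': "r \<le> norm A'"
        using abs_Im_le_cmod[of A'] y by (auto simp: A'_def e_def r_def)
      have nz: "A \<noteq> 0" "A' \<noteq> 0" using A A' r by auto
      have AA: "norm (A' - A) = 2 * y"
      proof -
        have "A' - A = - (of_real (2 * y) * \<i>)"
          by (simp add: A_def A'_def complex_eq_iff)
        then show ?thesis using y by (simp add: norm_mult)
      qed
      have "norm (?d x) = norm ((f (Complex x y) - h (Complex x (- y))) / A + h (Complex x (- y)) * (A' - A) / (A * A'))"
        unfolding A_def[symmetric] A'_def[symmetric] using nz by (simp add: field_simps)
      also have "\<dots> \<le> norm (f (Complex x y) - h (Complex x (- y))) / norm A + norm (h (Complex x (- y))) * (2 * y) / (norm A * norm A')"
        by (rule norm_triangle_le) (simp add: norm_divide norm_mult AA)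
      also have "\<dots> \<le> norm (f (Complex x y) - h (Complex x (- y))) / (r / 2) + norm (h (Complex x (- y))) * (2 * y) / (r / 2 * r)"
        using A A' r y by (intro add_mono divide_left_mono mult_mono mult_pos_pos) auto
      also have "\<dots> = 2 / r * norm (f (Complex x y) - h (Complex x (- y))) + 4 * y / r\<^sup>2 * norm (h (Complex x (- y)))"
        by (simp add: power2_eq_square mult_ac)
      finally have "ennreal (norm (?d x)) \<le> ennreal (2 / r * norm (f (Complex x y) - h (Complex x (- y))) + 4 * y / r\<^sup>2 * norm (h (Complex x (- y))))"
        by (rule ennreal_leI)
      also have "\<dots> = ennreal (2 / r) * ennreal (norm (f (Complex x y) - h (Complex x (- y))))
         + ennreal (4 * y / r\<^sup>2) * ennreal (norm (h (Complex x (- y))))"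
        using r y by (simp add: ennreal_mult[symmetric])
      finally show "ennreal (norm (?d x)) \<le> \<dots>" .
    qed
    also have "\<dots> = ennreal (2 / r) * (\<integral>\<^sup>+ x. ennreal (norm (f (Complex x y) - h (Complex x (- y)))) \<partial>lborel)
      + ennreal (4 * y / r\<^sup>2) * (\<integral>\<^sup>+ x. ennreal (norm (h (Complex x (- y)))) \<partial>lborel)"
      by (simp add: nn_integral_add nn_integral_cmult)
    also have "ennreal (4 * y / r\<^sup>2) * (\<integral>\<^sup>+ x. ennreal (norm (h (Complex x (- y)))) \<partial>lborel) \<le> ennreal (4 * y / r\<^sup>2) * ennreal B'"
      using Bh[of "- y"] y yb by (intro mult_left_mono) (auto simp: B'_def intro: order_trans ennreal_leI)
    also have "ennreal (4 * y / r\<^sup>2) * ennreal B' = ennreal (4 * y / r\<^sup>2 * B')"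
      by (rule ennreal_mult[symmetric]) (use y in \<open>auto simp: B'_def\<close>)
    finally show ?thesis by (simp add: add_left_mono)
  qed
  have "(\<lambda>n. ennreal (2 / r) * (\<integral>\<^sup>+ x. ennreal (norm (f (Complex x (\<eta> n)) - h (Complex x (- \<eta> n)))) \<partial>lborel)
      + ennreal (4 * \<eta> n / r\<^sup>2 * B')) \<longlonglongrightarrow> ennreal (2 / r) * 0 + ennreal (4 * 0 / r\<^sup>2 * B')"
    using r by (intro tendsto_add ennreal_tendsto_cmult lim tendsto_ennrealI tendsto_intros \<eta>) auto
  then have lim0: "(\<lambda>n. ennreal (2 / r) * (\<integral>\<^sup>+ x. ennreal (norm (f (Complex x (\<eta> n)) - h (Complex x (- \<eta> n)))) \<partial>lborel)
      + ennreal (4 * \<eta> n / r\<^sup>2 * B')) \<longlonglongrightarrow> 0" by simp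
  have "ennreal (norm (2 * pi * \<i> * f \<zeta> - (V a - U b))) \<le> 0"
  proof (rule tendsto_lowerbound[OF lim0])
    have "\<forall>\<^sub>F n in sequentially. \<eta> n < e"
      using \<eta>(2) e by (simp add: order_tendsto_iff)
    then show "\<forall>\<^sub>F n in sequentially. ennreal (norm (2 * pi * \<i> * f \<zeta> - (V a - U b)))
       \<le> ennreal (2 / r) * (\<integral>\<^sup>+ x. ennreal (norm (f (Complex x (\<eta> n)) - h (Complex x (- \<eta> n)))) \<partial>lborel)
      + ennreal (4 * \<eta> n / r\<^sup>2 * B')"
    proof eventually_elim
      case (elim n)
      then show ?case using bound[OF \<eta>(1) elim] id[OF \<eta>(1) elim] by simp
    qed
  qed simp
  then have "2 * pi * \<i> * f \<zeta> - (V a - U b) = 0"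
    by (simp add: ennreal_eq_0_iff)
  then show ?thesis by (simp add: U_def V_def)
qed

text \<open>
  A case of Vitali's convergence theorem. The part of \<open>h n\<close> below a level \<open>K\<close> is handled by dominated
  convergence. On the part above \<open>K\<close> one has \<open>|h n| \<le> K powr (1 - p) |h n| powr p\<close>, whose integral is small
  for large \<open>K\<close>, uniformly in \<open>n\<close>, because \<open>p > 1\<close>.
\<close>
lemma vitali_Lp_bounded:
  fixes h :: "nat \<Rightarrow> 'a \<Rightarrow> complex" and \<kappa> :: "'a \<Rightarrow> real"
  assumes [measurable]: "\<And>n. h n \<in> borel_measurable M" and \<kappa>: "integrable M \<kappa>" "\<And>x. 0 \<le> \<kappa> x"
    and lim: "AE x in M. (\<lambda>n. h n x) \<longlonglongrightarrow> 0"
    and p: "1 < p"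
    and B: "\<And>n. (\<integral>\<^sup>+ x. ennreal (norm (h n x) powr p * \<kappa> x) \<partial>M) \<le> ennreal B" "0 \<le> B"
  shows "(\<lambda>n. \<integral>\<^sup>+ x. ennreal (norm (h n x) * \<kappa> x) \<partial>M) \<longlonglongrightarrow> 0"
proof -
  have [measurable]: "\<kappa> \<in> borel_measurable M" using \<kappa> by auto
  have trunc: "(\<lambda>n. \<integral>\<^sup>+ x. ennreal (min (norm (h n x)) K * \<kappa> x) \<partial>M) \<longlonglongrightarrow> 0" if K: "0 < K" for K
  proof -
    have "(\<lambda>n. \<integral>\<^sup>+ x. ennreal (min (norm (h n x)) K * \<kappa> x) \<partial>M) \<longlonglongrightarrow> (\<integral>\<^sup>+ x. 0 \<partial>M)"
    proof (rule nn_integral_dominated_convergence[where w = "\<lambda>x. ennreal (K * \<kappa> x)"])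
      have "integrable M (\<lambda>x. K * \<kappa> x)" using \<kappa> by simp
      then show "(\<integral>\<^sup>+ x. ennreal (K * \<kappa> x) \<partial>M) < \<infinity>"
        using \<kappa>(2) K by (subst nn_integral_eq_integral) auto
      show "AE x in M. (\<lambda>n. ennreal (min (norm (h n x)) K * \<kappa> x)) \<longlonglongrightarrow> 0"
        using lim
      proof eventually_elim
        case (elim x)
        have "(\<lambda>n. ennreal (min (norm (h n x)) K * \<kappa> x)) \<longlonglongrightarrow> ennreal (min (norm (0::complex)) K * \<kappa> x)"
          by (intro tendsto_intros elim)
        then show ?case using K by simp
      qed
    qed (use \<kappa>(2) in \<open>auto intro!: ennreal_leI mult_right_mono\<close>)
    then show ?thesis by simp
  qed
  have split: "norm u \<le> min (norm u) K + K powr (1 - p) * norm u powr p" if "0 < K" for u :: complex and K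
  proof (cases "norm u \<le> K")
    case False
    then have "norm u = norm u powr (1 - p) * norm u powr p"
      using that by (simp flip: powr_add)
    also have "\<dots> \<le> K powr (1 - p) * norm u powr p"
      using False that p by (intro mult_right_mono powr_mono2') auto
    finally have "norm u \<le> K powr (1 - p) * norm u powr p" .
    moreover have "0 \<le> min (norm u) K" using that by auto
    ultimately show ?thesis by linarith
  qed (auto simp: min_def)
  have main: "(\<integral>\<^sup>+ x. ennreal (norm (h n x) * \<kappa> x) \<partial>M)
     \<le> (\<integral>\<^sup>+ x. ennreal (min (norm (h n x)) K * \<kappa> x) \<partial>M) + ennreal (K powr (1 - p) * B)" if "0 < K" for n K
  proof -
    have "(\<integral>\<^sup>+ x. ennreal (norm (h n x) * \<kappa> x) \<partial>M)
        \<le> (\<integral>\<^sup>+ x. ennreal (min (norm (h n x)) K * \<kappa> x) + ennreal (K powr (1 - p)) * ennreal (norm (h n x) powr p * \<kappa> x) \<partial>M)"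
    proof (rule nn_integral_mono)
      fix x
      have "norm (h n x) * \<kappa> x \<le> (min (norm (h n x)) K + K powr (1 - p) * norm (h n x) powr p) * \<kappa> x"
        using split[OF that] \<kappa>(2) by (intro mult_right_mono) auto
      then have "ennreal (norm (h n x) * \<kappa> x) \<le> ennreal (min (norm (h n x)) K * \<kappa> x + K powr (1 - p) * (norm (h n x) powr p * \<kappa> x))"
        by (intro ennreal_leI) (simp add: algebra_simps)
      also have "\<dots> = ennreal (min (norm (h n x)) K * \<kappa> x) + ennreal (K powr (1 - p)) * ennreal (norm (h n x) powr p * \<kappa> x)"
        using that \<kappa>(2)[of x] by (subst ennreal_plus) (auto simp: ennreal_mult)
      finally show "ennreal (norm (h n x) * \<kappa> x) \<le> \<dots>" .
    qed
    also have "\<dots> = (\<integral>\<^sup>+ x. ennreal (min (norm (h n x)) K * \<kappa> x) \<partial>M)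
        + ennreal (K powr (1 - p)) * (\<integral>\<^sup>+ x. ennreal (norm (h n x) powr p * \<kappa> x) \<partial>M)"
      by (simp add: nn_integral_add nn_integral_cmult)
    also have "ennreal (K powr (1 - p)) * (\<integral>\<^sup>+ x. ennreal (norm (h n x) powr p * \<kappa> x) \<partial>M) \<le> ennreal (K powr (1 - p)) * ennreal B"
      by (intro mult_left_mono B) auto
    also have "ennreal (K powr (1 - p)) * ennreal B = ennreal (K powr (1 - p) * B)"
      using B(2) by (simp add: ennreal_mult)
    finally show ?thesis by (simp add: add_left_mono)
  qed
  have Klim: "((\<lambda>K. K powr (1 - p) * B) \<longlongrightarrow> 0) at_top"
  proof -
    have "((\<lambda>K. K powr (1 - p)) \<longlongrightarrow> 0) at_top"
      using p by (intro tendsto_neg_powr filterlim_ident) auto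
    then show ?thesis by (auto intro: tendsto_mult_left_zero)
  qed
  show ?thesis
  proof (rule order_tendstoI)
    fix e :: ennreal assume "0 < e"
    then obtain d where d: "0 < d" "d < e" using dense by blast
    then obtain e' where "d = ennreal e'" by (cases d) auto
    with d have e': "0 < e'" "ennreal e' < e" by auto
    have "\<forall>\<^sub>F K in at_top. K powr (1 - p) * B < e' / 2"
      by (rule order_tendstoD(2)[OF Klim]) (use e' in simp)
    then have "\<forall>\<^sub>F K in at_top. 0 < K \<and> K powr (1 - p) * B < e' / 2"
      using eventually_gt_at_top[of 0] by eventually_elim auto
    then obtain K where K: "0 < K" "K powr (1 - p) * B < e' / 2"
      using eventually_happens by force
    have "\<forall>\<^sub>F n in sequentially. (\<integral>\<^sup>+ x. ennreal (min (norm (h n x)) K * \<kappa> x) \<partial>M) < ennreal (e' / 2)"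
      using trunc[OF K(1)] e' by (intro order_tendstoD(2)) auto
    then show "\<forall>\<^sub>F n in sequentially. (\<integral>\<^sup>+ x. ennreal (norm (h n x) * \<kappa> x) \<partial>M) < e"
    proof eventually_elim
      case (elim n)
      have "(\<integral>\<^sup>+ x. ennreal (norm (h n x) * \<kappa> x) \<partial>M) \<le> ennreal (e' / 2) + ennreal (e' / 2)"
        using main[OF K(1), of n] elim K(2) by (elim order_trans) (intro add_mono ennreal_leI; simp)
      also have "\<dots> = ennreal e'"
        using e' by (simp flip: ennreal_plus)
      finally show ?case using e' by simp
    qed
  qed auto
qed

section \<open>Kernels and weights on horizontal lines\<close>

text \<open>
  The integral of \<open>|x + i| powr (- q)\<close> over the line. By scaling, the powers of all kernels \<open>1 / (x - z)\<close> integrate to a power of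
  \<open>|Im z|\<close> times this constant.
\<close>
definition kernel_const :: "real \<Rightarrow> real" where
  "kernel_const q = enn2real (\<integral>\<^sup>+ x. ennreal ((1 / norm (Complex x 1)) powr q) \<partial>lborel)"

lemma norm_Complex_measurable [measurable]:
  "(\<lambda>x. norm (Complex (x - a) y)) \<in> borel_measurable borel"
  by (intro borel_measurable_continuous_onI continuous_intros)

lemma kernel_const_nonneg: "0 \<le> kernel_const q"
  by (simp add: kernel_const_def)

lemma nn_integral_kernel_one:
  assumes "1 < q"
  shows "(\<integral>\<^sup>+ x. ennreal ((1 / norm (Complex x 1)) powr q) \<partial>lborel) = ennreal (kernel_const q)"
proof -
  let ?k = "\<lambda>x. ennreal ((1 / norm (Complex x 1)) powr q)"
  let ?w = "\<lambda>x::real. indicator {1..} x * ennreal (x powr (- q))"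
  have w: "(\<integral>\<^sup>+ x. ?w x \<partial>lborel) < \<infinity>"
    using nn_integral_has_integral_lebesgue'[OF _ has_integral_powr_to_inf[of "- q" 1]] assms
    by (simp add: mult.commute)
  have w': "(\<integral>\<^sup>+ x. ?w (- x) \<partial>lborel) < \<infinity>"
    using w nn_integral_real_affine[of ?w "-1" 0] by simp
  have "(\<integral>\<^sup>+ x. ?k x \<partial>lborel) \<le> (\<integral>\<^sup>+ x. indicator {-1..1} x + (?w x + ?w (- x)) \<partial>lborel)"
  proof (rule nn_integral_mono)
    fix x :: real
    have 1: "(1 / norm (Complex x 1)) powr q \<le> 1"
    proof -
      have "1 \<le> norm (Complex x 1)" using abs_Im_le_cmod[of "Complex x 1"] by simp
      then show ?thesis using assms by (intro powr_le1) (auto simp: divide_le_eq)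
    qed
    have 2: "(1 / norm (Complex x 1)) powr q \<le> \<bar>x\<bar> powr (- q)" if "1 \<le> \<bar>x\<bar>"
    proof -
      have "\<bar>x\<bar> \<le> norm (Complex x 1)" using abs_Re_le_cmod[of "Complex x 1"] by simp
      then have "(1 / norm (Complex x 1)) powr q \<le> (1 / \<bar>x\<bar>) powr q"
        using assms that by (intro powr_mono2 divide_left_mono mult_pos_pos) auto
      also have "\<dots> = \<bar>x\<bar> powr (- q)"
        using that by (simp add: powr_divide powr_minus_divide)
      finally show ?thesis .
    qed
    consider "\<bar>x\<bar> \<le> 1" | "1 \<le> x" | "x \<le> -1" by linarith
    then show "?k x \<le> indicator {-1..1} x + (?w x + ?w (- x))"
    proof cases
      case 1
      then have "?k x \<le> indicator {-1..1} x" using \<open>(1 / norm (Complex x 1)) powr q \<le> 1\<close> by (simp add: abs_le_iff)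
      then show ?thesis by (rule order_trans) simp
    next
      case 2
      then have "?k x \<le> ?w x" using \<open>1 \<le> \<bar>x\<bar> \<Longrightarrow> _\<close> by (auto intro!: ennreal_leI)
      then show ?thesis by (rule order_trans) (simp add: add_increasing)
    next
      case 3
      then have "?k x \<le> ?w (- x)" using \<open>1 \<le> \<bar>x\<bar> \<Longrightarrow> _\<close> by (auto intro!: ennreal_leI)
      then show ?thesis by (rule order_trans) (simp add: add_increasing)
    qed
  qed
  also have "\<dots> = (\<integral>\<^sup>+ x. indicator {-1..1::real} x \<partial>lborel) + ((\<integral>\<^sup>+ x. ?w x \<partial>lborel) + (\<integral>\<^sup>+ x. ?w (- x) \<partial>lborel))"
    by (simp add: nn_integral_add)
  also have "\<dots> < \<infinity>"
    using w w' by simp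
  finally show ?thesis
    by (simp add: kernel_const_def)
qed

lemma nn_integral_kernel:
  assumes "1 < q" "y \<noteq> 0"
  shows "(\<integral>\<^sup>+ x. ennreal ((1 / norm (Complex (x - a) y)) powr q) \<partial>lborel) = ennreal (\<bar>y\<bar> powr (1 - q) * kernel_const q)"
proof -
  have eq: "norm (Complex (\<bar>y\<bar> * x) y) = \<bar>y\<bar> * norm (Complex x 1)" for x
    by (simp add: cmod_def power_mult_distrib distrib_left[symmetric] real_sqrt_mult flip: distrib_left)
       (metis (no_types) add.commute distrib_left mult.right_neutral real_sqrt_abs real_sqrt_mult)
  have "(\<integral>\<^sup>+ x. ennreal ((1 / norm (Complex (x - a) y)) powr q) \<partial>lborel)
      = ennreal \<bar>y\<bar> * (\<integral>\<^sup>+ x. ennreal ((1 / norm (Complex (\<bar>y\<bar> * x) y)) powr q) \<partial>lborel)"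
    using assms by (subst nn_integral_real_affine[where c = "\<bar>y\<bar>" and t = a]) auto
  also have "\<dots> = ennreal \<bar>y\<bar> * (\<integral>\<^sup>+ x. ennreal (\<bar>y\<bar> powr (- q)) * ennreal ((1 / norm (Complex x 1)) powr q) \<partial>lborel)"
    unfolding eq using assms
    by (simp add: powr_divide powr_mult powr_minus divide_inverse ennreal_mult[symmetric] inverse_powr mult.commute)
  also have "\<dots> = ennreal \<bar>y\<bar> * (ennreal (\<bar>y\<bar> powr (- q)) * (\<integral>\<^sup>+ x. ennreal ((1 / norm (Complex x 1)) powr q) \<partial>lborel))"
    using norm_Complex_measurable[of 0 1] by (subst nn_integral_cmult) auto
  also have "\<dots> = ennreal (\<bar>y\<bar> * \<bar>y\<bar> powr (- q) * kernel_const q)"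
    using assms kernel_const_nonneg[of q] by (simp add: nn_integral_kernel_one ennreal_mult mult.assoc)
  also have "\<bar>y\<bar> * \<bar>y\<bar> powr (- q) = \<bar>y\<bar> powr (1 - q)"
    using assms by (metis abs_ge_zero powr_mult_base uminus_add_conv_diff add_uminus_conv_diff)
  finally show ?thesis .
qed

text \<open>
  Up to a factor this is the density of the Cauchy distribution centred at \<open>Re z\<close> with scale \<open>|Im z|\<close>. An \<open>L\<^sub>p\<close> condition with this finite
  measure covers both functions that are in \<open>L\<^sub>p\<close> for Lebesgue measure and bounded functions.
\<close>
definition cauchy_weight :: "complex \<Rightarrow> real \<Rightarrow> real" where
  "cauchy_weight z x = 1 / (norm (Complex x 0 - z))\<^sup>2"

lemma cauchy_weight_nonneg: "0 \<le> cauchy_weight z x"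
  by (simp add: cauchy_weight_def)

lemma cauchy_weight_measurable [measurable]: "cauchy_weight z \<in> borel_measurable borel"
proof -
  have "(\<lambda>x. norm (Complex x 0 - z)) \<in> borel_measurable borel"
    by (intro borel_measurable_continuous_onI continuous_intros)
  then show ?thesis unfolding cauchy_weight_def[abs_def] by measurable
qed

lemma cauchy_weight_le_1:
  assumes "1 \<le> \<bar>Im z\<bar>"
  shows "cauchy_weight z x \<le> 1"
proof -
  have "1 \<le> norm (Complex x 0 - z)"
    using abs_Im_le_cmod[of "Complex x 0 - z"] assms by simp
  then show ?thesis by (simp add: cauchy_weight_def divide_le_eq)
qed

lemma nn_integral_cauchy_weight:
  assumes "1 \<le> \<bar>Im z\<bar>"
  shows "(\<integral>\<^sup>+ x. ennreal (cauchy_weight z x) \<partial>lborel) \<le> ennreal (kernel_const 2)"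
proof -
  have "(\<integral>\<^sup>+ x. ennreal (cauchy_weight z x) \<partial>lborel) = (\<integral>\<^sup>+ x. ennreal ((1 / norm (Complex (x - Re z) (- Im z))) powr 2) \<partial>lborel)"
  proof (rule nn_integral_cong)
    fix x
    have "Complex x 0 - z = Complex (x - Re z) (- Im z)" by (simp add: complex_eq_iff)
    then show "ennreal (cauchy_weight z x) = ennreal ((1 / norm (Complex (x - Re z) (- Im z))) powr 2)"
      unfolding cauchy_weight_def by (simp add: powr_numeral power_divide)
  qed
  also have "\<dots> = ennreal (\<bar>Im z\<bar> powr (1 - 2) * kernel_const 2)"
    using assms by (subst nn_integral_kernel) auto
  also have "\<dots> \<le> ennreal (1 * kernel_const 2)"
  proof (intro ennreal_leI mult_right_mono kernel_const_nonneg)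
    show "\<bar>Im z\<bar> powr (1 - 2) \<le> 1"
      using assms powr_mono2'[of "-1" 1 "\<bar>Im z\<bar>"] by simp
  qed
  finally show ?thesis by simp
qed

lemma integrable_cauchy_weight:
  assumes "1 \<le> \<bar>Im z\<bar>"
  shows "integrable lborel (cauchy_weight z)"
proof (rule integrableI_bounded)
  have "(\<integral>\<^sup>+ x. ennreal (norm (cauchy_weight z x)) \<partial>lborel) = (\<integral>\<^sup>+ x. ennreal (cauchy_weight z x) \<partial>lborel)"
    by (simp add: cauchy_weight_nonneg)
  also have "\<dots> \<le> ennreal (kernel_const 2)"
    by (rule nn_integral_cauchy_weight[OF assms])
  finally show "(\<integral>\<^sup>+ x. ennreal (norm (cauchy_weight z x)) \<partial>lborel) < \<infinity>"
    by (simp add: order_le_less_trans)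
qed simp

text \<open>
  The factor 4 is the price for comparing all lines at height \<open>y \<ge> Im z / 2\<close>, also those below the real line, with the one
  weight on the real line.
\<close>
lemma inverse_square_le_weight:
  assumes "Im z \<le> - 1" "Im z / 2 \<le> y"
  shows "1 / (norm (Complex x y - z))\<^sup>2 \<le> 4 * cauchy_weight z x"
proof -
  have "norm (Complex x 0 - z) \<le> 2 * norm (Complex x y - z)"
  proof (rule power2_le_imp_le)
    have "(Im z)\<^sup>2 \<le> (2 * (y - Im z))\<^sup>2"
      using assms by (intro iffD1[OF abs_le_square_iff]) auto
    also have "\<dots> = 4 * (y - Im z)\<^sup>2"
      by (subst power_mult_distrib) simp
    finally show "(norm (Complex x 0 - z))\<^sup>2 \<le> (2 * norm (Complex x y - z))\<^sup>2"
      by (simp add: cmod_power2 power_mult_distrib add_increasing)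
  qed simp
  moreover have "0 < norm (Complex x 0 - z)" "0 < norm (Complex x y - z)"
    using assms by (auto simp: complex_eq_iff)
  ultimately show ?thesis
    using power_mono[of "norm (Complex x 0 - z)" "2 * norm (Complex x y - z)" 2]
    by (simp add: cauchy_weight_def divide_simps power_mult_distrib)
qed

text \<open>
  Since \<open>u \<le> 1 + u powr p\<close> for \<open>u \<ge> 0\<close>, the division by \<open>(w - z)\<^sup>2\<close> turns a weighted \<open>L\<^sub>p\<close> bound into a bound
  in \<open>L\<^sub>1\<close>. The bound does not depend on \<open>Re z\<close>, which will make the estimates of Hardy functions uniform in
  the horizontal direction.
\<close>
lemma nn_integral_weighted:
  assumes z: "Im z \<le> - 1" "Im z / 2 \<le> y" and p: "1 < p"
    and [measurable]: "(\<lambda>x. F (Complex x y)) \<in> borel_measurable borel"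
    and B: "(\<integral>\<^sup>+ x. ennreal (norm (F (Complex x y)) powr p * cauchy_weight z x) \<partial>lborel) \<le> ennreal B" "0 \<le> B"
  shows "(\<integral>\<^sup>+ x. ennreal (norm (F (Complex x y) / (Complex x y - z)\<^sup>2)) \<partial>lborel) \<le> ennreal (4 * (kernel_const 2 + B))"
proof -
  have "(\<integral>\<^sup>+ x. ennreal (norm (F (Complex x y) / (Complex x y - z)\<^sup>2)) \<partial>lborel)
     \<le> (\<integral>\<^sup>+ x. 4 * (ennreal (cauchy_weight z x) + ennreal (norm (F (Complex x y)) powr p * cauchy_weight z x)) \<partial>lborel)"
  proof (rule nn_integral_mono)
    fix x
    have le: "norm u \<le> 1 + norm u powr p" for u :: complex
    proof (cases "norm u \<le> 1")
      case False
      then have "norm u powr 1 \<le> norm u powr p" using p by (intro powr_mono) auto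
      then show ?thesis using False by simp
    qed (simp add: add_increasing2)
    have "norm (F (Complex x y) / (Complex x y - z)\<^sup>2) = norm (F (Complex x y)) * (1 / (norm (Complex x y - z))\<^sup>2)"
      by (simp add: norm_divide norm_power)
    also have "\<dots> \<le> (1 + norm (F (Complex x y)) powr p) * (4 * cauchy_weight z x)"
      by (intro mult_mono le inverse_square_le_weight z) auto
    finally have "ennreal (norm (F (Complex x y) / (Complex x y - z)\<^sup>2)) \<le> ennreal (4 * (cauchy_weight z x + norm (F (Complex x y)) powr p * cauchy_weight z x))"
      by (intro ennreal_leI) (simp add: algebra_simps)
    also have "\<dots> = 4 * (ennreal (cauchy_weight z x) + ennreal (norm (F (Complex x y)) powr p * cauchy_weight z x))"
      using cauchy_weight_nonneg[of z x] by (simp add: ennreal_mult)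
    finally show "ennreal (norm (F (Complex x y) / (Complex x y - z)\<^sup>2)) \<le> \<dots>" .
  qed
  also have "\<dots> = 4 * ((\<integral>\<^sup>+ x. ennreal (cauchy_weight z x) \<partial>lborel)
      + (\<integral>\<^sup>+ x. ennreal (norm (F (Complex x y)) powr p * cauchy_weight z x) \<partial>lborel))"
    by (simp add: nn_integral_add nn_integral_cmult)
  also have "\<dots> \<le> 4 * (ennreal (kernel_const 2) + ennreal B)"
    using z by (intro mult_left_mono add_mono nn_integral_cauchy_weight B) auto
  also have "\<dots> = ennreal (4 * (kernel_const 2 + B))"
    using B kernel_const_nonneg[of 2] by (simp add: ennreal_mult)
  finally show ?thesis .
qed

lemma measurable_on_line:
  assumes "F holomorphic_on S" "\<And>x. Complex x y \<in> S"
  shows "(\<lambda>x. F (Complex x y)) \<in> borel_measurable borel"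
  by (intro borel_measurable_continuous_onI continuous_on_compose2[OF holomorphic_on_imp_continuous_on[OF assms(1)]]
      continuous_intros) (use assms in auto)

text \<open>
  The gluing formula for \<open>F w / (w - z)\<^sup>2\<close> and \<open>H w / (w - z)\<^sup>2\<close>. If \<open>F\<close> and \<open>H\<close> have the same boundary function \<open>u\<close>, then their
  difference across the line tends to 0 almost everywhere, and Vitali's theorem for the Cauchy weight yields the
  convergence in the mean that \<open>glue_across_line\<close> requires.
\<close>
lemma glue_weighted:
  assumes F: "F holomorphic_on {w. 0 < Im w \<and> Im w < \<beta>}" and H: "H holomorphic_on {w. \<alpha> < Im w \<and> Im w < 0}"
    and p: "1 < p" and z: "Im z \<le> - 1" "Im z / 2 \<le> \<alpha>"
    and BF: "\<And>y. 0 < y \<Longrightarrow> y < \<beta> \<Longrightarrow> (\<integral>\<^sup>+ x. ennreal (norm (F (Complex x y)) powr p * cauchy_weight z x) \<partial>lborel) \<le> ennreal B"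
    and BH: "\<And>y. \<alpha> < y \<Longrightarrow> y < 0 \<Longrightarrow> (\<integral>\<^sup>+ x. ennreal (norm (H (Complex x y)) powr p * cauchy_weight z x) \<partial>lborel) \<le> ennreal B"
    and B: "0 \<le> B"
    and \<eta>: "\<And>n. 0 < \<eta> n" "\<And>n. \<eta> n < \<beta>" "\<And>n. \<eta> n < - \<alpha>" "\<eta> \<longlonglongrightarrow> 0"
    and limF: "AE x in lborel. (\<lambda>n. F (Complex x (\<eta> n))) \<longlonglongrightarrow> u x"
    and limH: "AE x in lborel. (\<lambda>n. H (Complex x (- \<eta> n))) \<longlonglongrightarrow> u x"
    and \<zeta>: "0 < Im \<zeta>" "Im \<zeta> < b" "b < \<beta>" "\<alpha> < a" "a < 0"
  shows "2 * pi * \<i> * (F \<zeta> / (\<zeta> - z)\<^sup>2) = (LINT x|lborel. H (Complex x a) / (Complex x a - z)\<^sup>2 / (Complex x a - \<zeta>))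
           - (LINT x|lborel. F (Complex x b) / (Complex x b - z)\<^sup>2 / (Complex x b - \<zeta>))"
proof (rule glue_across_line[where \<eta> = \<eta> and f = "\<lambda>w. F w / (w - z)\<^sup>2" and h = "\<lambda>w. H w / (w - z)\<^sup>2"])
  have nz: "z \<noteq> w" if "\<alpha> < Im w" for w using that z by auto
  show "(\<lambda>w. F w / (w - z)\<^sup>2) holomorphic_on {w. 0 < Im w \<and> Im w < \<beta>}"
    using z by (intro holomorphic_intros F) auto
  show "(\<lambda>w. H w / (w - z)\<^sup>2) holomorphic_on {w. \<alpha> < Im w \<and> Im w < 0}"
    using nz by (intro holomorphic_intros H) auto
  have mF [measurable]: "(\<lambda>x. F (Complex x y)) \<in> borel_measurable borel" if "0 < y" "y < \<beta>" for y
    using that by (intro measurable_on_line[OF F]) auto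
  have mH [measurable]: "(\<lambda>x. H (Complex x y)) \<in> borel_measurable borel" if "\<alpha> < y" "y < 0" for y
    using that by (intro measurable_on_line[OF H]) auto
  show "(\<integral>\<^sup>+ x. ennreal (norm (F (Complex x y) / (Complex x y - z)\<^sup>2)) \<partial>lborel) \<le> ennreal (4 * (kernel_const 2 + B))"
    if "0 < y" "y < \<beta>" for y
    using that z by (intro nn_integral_weighted[OF _ _ p] BF B mF) auto
  show "(\<integral>\<^sup>+ x. ennreal (norm (H (Complex x y) / (Complex x y - z)\<^sup>2)) \<partial>lborel) \<le> ennreal (4 * (kernel_const 2 + B))"
    if "\<alpha> < y" "y < 0" for y
    using that z by (intro nn_integral_weighted[OF _ _ p] BH B mH) auto
  \<comment> \<open>Division by the weight makes the integral of \<open>|h n|\<close> against the weight equal to the mean difference across the line.\<close>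
  define h where "h = (\<lambda>n x. (F (Complex x (\<eta> n)) / (Complex x (\<eta> n) - z)\<^sup>2
       - H (Complex x (- \<eta> n)) / (Complex x (- \<eta> n) - z)\<^sup>2) / of_real (cauchy_weight z x))"
  have wpos: "0 < cauchy_weight z x" for x
    using z by (auto simp: cauchy_weight_def complex_eq_iff)
  have [measurable]: "(\<lambda>x. F (Complex x (\<eta> n))) \<in> borel_measurable borel" "(\<lambda>x. H (Complex x (- \<eta> n))) \<in> borel_measurable borel"
    "(\<lambda>x. Complex x y - z) \<in> borel_measurable borel" for n y
    using \<eta>(1-3)[of n] by (auto intro!: mF mH borel_measurable_continuous_onI continuous_intros)
  have [measurable]: "h n \<in> borel_measurable lborel" for n
    unfolding h_def by measurable
  have hn: "norm (h n x) * cauchy_weight z x = norm (F (Complex x (\<eta> n)) / (Complex x (\<eta> n) - z)\<^sup>2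
       - H (Complex x (- \<eta> n)) / (Complex x (- \<eta> n) - z)\<^sup>2)" for n x
    using wpos[of x] unfolding h_def by (simp add: norm_divide)
  have "(\<lambda>n. \<integral>\<^sup>+ x. ennreal (norm (h n x) * cauchy_weight z x) \<partial>lborel) \<longlonglongrightarrow> 0"
  proof (rule vitali_Lp_bounded[OF _ _ _ _ p])
    show "integrable lborel (cauchy_weight z)"
      using z by (intro integrable_cauchy_weight) auto
    show "AE x in lborel. (\<lambda>n. h n x) \<longlonglongrightarrow> 0"
      using limF limH
    proof eventually_elim
      case (elim x)
      have ce: "Complex x y - z = of_real x + \<i> * of_real y - z" for y
        by (simp add: complex_eq_iff)
      have nz: "of_real x + \<i> * of_real 0 - z \<noteq> 0"
        using z by (auto simp: complex_eq_iff)
      have "(\<lambda>n. (F (Complex x (\<eta> n)) / (Complex x (\<eta> n) - z)\<^sup>2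
       - H (Complex x (- \<eta> n)) / (Complex x (- \<eta> n) - z)\<^sup>2) / of_real (cauchy_weight z x))
       \<longlonglongrightarrow> (u x / (of_real x + \<i> * of_real 0 - z)\<^sup>2 - u x / (of_real x + \<i> * of_real (- 0) - z)\<^sup>2) / of_real (cauchy_weight z x)"
        unfolding ce using nz wpos[of x] by (intro tendsto_intros elim \<eta>) auto
      then show ?case by (simp add: h_def)
    qed
    show "(\<integral>\<^sup>+ x. ennreal (norm (h n x) powr p * cauchy_weight z x) \<partial>lborel) \<le> ennreal (2 * (8 powr p * B))" for n
    proof -
      have "(\<integral>\<^sup>+ x. ennreal (norm (h n x) powr p * cauchy_weight z x) \<partial>lborel)
        \<le> (\<integral>\<^sup>+ x. ennreal (8 powr p) * (ennreal (norm (F (Complex x (\<eta> n))) powr p * cauchy_weight z x)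
               + ennreal (norm (H (Complex x (- \<eta> n))) powr p * cauchy_weight z x)) \<partial>lborel)"
      proof (rule nn_integral_mono)
        fix x
        let ?a = "norm (F (Complex x (\<eta> n)))" and ?b = "norm (H (Complex x (- \<eta> n)))" and ?w = "cauchy_weight z x"
        have "norm (h n x) * ?w \<le> ?a * (1 / (norm (Complex x (\<eta> n) - z))\<^sup>2) + ?b * (1 / (norm (Complex x (- \<eta> n) - z))\<^sup>2)"
          unfolding hn by (rule order_trans[OF norm_triangle_ineq4]) (simp add: norm_divide norm_power)
        also have "\<dots> \<le> ?a * (4 * ?w) + ?b * (4 * ?w)"
          using \<eta>(1-3)[of n] z by (intro add_mono mult_left_mono inverse_square_le_weight) auto
        also have "\<dots> = (4 * ?a + 4 * ?b) * ?w" by (simp add: algebra_simps)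
        finally have "norm (h n x) \<le> 4 * ?a + 4 * ?b"
          using wpos[of x] by simp
        also have "\<dots> \<le> 8 * max ?a ?b" by simp
        finally have "norm (h n x) powr p \<le> (8 * max ?a ?b) powr p"
          using p by (intro powr_mono2) auto
        also have "\<dots> = 8 powr p * (max ?a ?b) powr p" by (simp add: powr_mult)
        also have "(max ?a ?b) powr p \<le> ?a powr p + ?b powr p" by (auto simp: max_def)
        finally have "norm (h n x) powr p * ?w \<le> 8 powr p * (?a powr p + ?b powr p) * ?w"
          using wpos[of x] by (simp add: mult_right_mono)
        then have "ennreal (norm (h n x) powr p * ?w) \<le> ennreal (8 powr p * (?a powr p * ?w + ?b powr p * ?w))"
          by (intro ennreal_leI) (simp add: algebra_simps)
        also have "\<dots> = ennreal (8 powr p) * (ennreal (?a powr p * ?w) + ennreal (?b powr p * ?w))"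
          using cauchy_weight_nonneg[of z x] by (simp add: ennreal_mult)
        finally show "ennreal (norm (h n x) powr p * ?w) \<le> \<dots>" .
      qed
      also have "\<dots> = ennreal (8 powr p) * ((\<integral>\<^sup>+ x. ennreal (norm (F (Complex x (\<eta> n))) powr p * cauchy_weight z x) \<partial>lborel)
               + (\<integral>\<^sup>+ x. ennreal (norm (H (Complex x (- \<eta> n))) powr p * cauchy_weight z x) \<partial>lborel))"
        by (simp add: nn_integral_add nn_integral_cmult)
      also have "\<dots> \<le> ennreal (8 powr p) * (ennreal B + ennreal B)"
        using \<eta>(1-3)[of n] by (intro mult_left_mono add_mono BF BH) auto
      also have "\<dots> = ennreal (2 * (8 powr p * B))"
        using B by (simp flip: ennreal_plus ennreal_mult)
      finally show ?thesis .
    qed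
    show "0 \<le> 2 * (8 powr p * B)" using B by simp
  qed (auto simp: cauchy_weight_nonneg)
  then show "(\<lambda>n. \<integral>\<^sup>+ x. ennreal (norm (F (Complex x (\<eta> n)) / (Complex x (\<eta> n) - z)\<^sup>2
       - H (Complex x (- \<eta> n)) / (Complex x (- \<eta> n) - z)\<^sup>2)) \<partial>lborel) \<longlonglongrightarrow> 0"
    by (simp add: hn)
qed (use \<zeta> \<eta> in auto)

lemma glue_weighted_bound:
  assumes F: "F holomorphic_on {w. 0 < Im w \<and> Im w < \<beta>}" and H: "H holomorphic_on {w. \<alpha> < Im w \<and> Im w < 0}"
    and p: "1 < p" and z: "Im z \<le> - 1" "Im z / 2 \<le> \<alpha>"
    and BF: "\<And>y. 0 < y \<Longrightarrow> y < \<beta> \<Longrightarrow> (\<integral>\<^sup>+ x. ennreal (norm (F (Complex x y)) powr p * cauchy_weight z x) \<partial>lborel) \<le> ennreal B"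
    and BH: "\<And>y. \<alpha> < y \<Longrightarrow> y < 0 \<Longrightarrow> (\<integral>\<^sup>+ x. ennreal (norm (H (Complex x y)) powr p * cauchy_weight z x) \<partial>lborel) \<le> ennreal B"
    and B: "0 \<le> B"
    and \<eta>: "\<And>n. 0 < \<eta> n" "\<And>n. \<eta> n < \<beta>" "\<And>n. \<eta> n < - \<alpha>" "\<eta> \<longlonglongrightarrow> 0"
    and limF: "AE x in lborel. (\<lambda>n. F (Complex x (\<eta> n))) \<longlonglongrightarrow> u x"
    and limH: "AE x in lborel. (\<lambda>n. H (Complex x (- \<eta> n))) \<longlonglongrightarrow> u x"
    and \<zeta>: "0 < Im \<zeta>" "Im \<zeta> < b" "b < \<beta>" "\<alpha> < a" "a < 0"
  shows "2 * pi * norm (F \<zeta> / (\<zeta> - z)\<^sup>2) \<le> norm (LINT x|lborel. H (Complex x a) / (Complex x a - z)\<^sup>2 / (Complex x a - \<zeta>))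
     + 4 * (kernel_const 2 + B) / (b - Im \<zeta>)"
    and "norm (LINT x|lborel. H (Complex x a) / (Complex x a - z)\<^sup>2 / (Complex x a - \<zeta>)) \<le> 4 * (kernel_const 2 + B) / (Im \<zeta> - a)"
proof -
  have nz: "z \<noteq> w" if "\<alpha> < Im w" for w using that z by auto
  have hF: "(\<lambda>w. F w / (w - z)\<^sup>2) holomorphic_on {w. 0 < Im w \<and> Im w < \<beta>}"
    using z by (intro holomorphic_intros F) auto
  have hH: "(\<lambda>w. H w / (w - z)\<^sup>2) holomorphic_on {w. \<alpha> < Im w \<and> Im w < 0}"
    using nz by (intro holomorphic_intros H) auto
  let ?U = "LINT x|lborel. F (Complex x b) / (Complex x b - z)\<^sup>2 / (Complex x b - \<zeta>)"
  let ?V = "LINT x|lborel. H (Complex x a) / (Complex x a - z)\<^sup>2 / (Complex x a - \<zeta>)"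
  have k: "0 \<le> 4 * (kernel_const 2 + B)" using B kernel_const_nonneg[of 2] by simp
  have U: "norm ?U \<le> max 0 (4 * (kernel_const 2 + B)) / \<bar>Im \<zeta> - b\<bar>"
    using \<zeta> z by (intro integrable_line_kernel(3)[where f = "\<lambda>w. F w / (w - z)\<^sup>2"] nn_integral_weighted[OF _ _ p] BF B measurable_on_line[OF F]
       continuous_on_subset[OF holomorphic_on_imp_continuous_on[OF hF]]) auto
  have V: "norm ?V \<le> max 0 (4 * (kernel_const 2 + B)) / \<bar>Im \<zeta> - a\<bar>"
    using \<zeta> z by (intro integrable_line_kernel(3)[where f = "\<lambda>w. H w / (w - z)\<^sup>2"] nn_integral_weighted[OF _ _ p] BH B measurable_on_line[OF H]
       continuous_on_subset[OF holomorphic_on_imp_continuous_on[OF hH]]) auto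
  then show "norm ?V \<le> 4 * (kernel_const 2 + B) / (Im \<zeta> - a)" using \<zeta> k by simp
  have "2 * pi * norm (F \<zeta> / (\<zeta> - z)\<^sup>2) = norm (2 * pi * \<i> * (F \<zeta> / (\<zeta> - z)\<^sup>2))"
    by (simp add: norm_mult norm_divide)
  also have "\<dots> = norm (?V - ?U)"
    by (subst glue_weighted[OF F H p z BF BH B \<eta> limF limH \<zeta>]) auto
  also have "\<dots> \<le> norm ?V + norm ?U" by (rule norm_triangle_ineq4)
  finally show "2 * pi * norm (F \<zeta> / (\<zeta> - z)\<^sup>2) \<le> norm ?V + 4 * (kernel_const 2 + B) / (b - Im \<zeta>)"
    using U \<zeta> k by simp
qed

section \<open>Hardy functions and their boundary values\<close>

lemma boundary_values_vertical:
  assumes bv: "has_boundary_values \<Omega> F f" and \<Omega>: "\<And>n x. Complex x (\<eta> n) \<in> \<Omega>" and \<eta>: "\<eta> \<longlonglongrightarrow> 0" "\<And>n. \<eta> n \<noteq> 0"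
  shows "AE x in lborel. (\<lambda>n. F (Complex x (\<eta> n))) \<longlonglongrightarrow> f x"
  using bv unfolding has_boundary_values_def
proof eventually_elim
  case (elim x)
  have "(F \<longlongrightarrow> f x) (at (of_real x) within stolz_cone \<Omega> x 1)"
    using elim zero_less_one by blast
  moreover have "filterlim (\<lambda>n. Complex x (\<eta> n)) (at (of_real x) within stolz_cone \<Omega> x 1) sequentially"
    unfolding filterlim_at
  proof (intro conjI always_eventually allI)
    have "(\<lambda>n. of_real x + \<i> * of_real (\<eta> n)) \<longlonglongrightarrow> of_real x + \<i> * of_real 0"
      by (intro tendsto_intros \<eta>)
    then show "(\<lambda>n. Complex x (\<eta> n)) \<longlonglongrightarrow> of_real x"
      by (simp add: Complex_eq)
  next
    fix n show "Complex x (\<eta> n) \<in> stolz_cone \<Omega> x 1" "Complex x (\<eta> n) \<noteq> of_real x"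
      using \<Omega>[of x n] \<eta>(2)[of n] by (auto simp: stolz_cone_def complex_eq_iff)
  qed
  ultimately show ?case by (rule filterlim_compose)
qed

lemma hardy_funE:
  assumes "F \<in> hardy_fun p \<Omega>"
  obtains B where "F holomorphic_on \<Omega>" "0 \<le> B"
    "\<And>y. \<i> * of_real y \<in> \<Omega> \<Longrightarrow> (\<integral>\<^sup>+ x. ennreal (norm (F (Complex x y)) powr p) \<partial>lborel) \<le> ennreal B"
proof -
  let ?S = "SUP y\<in>{y. \<i> * of_real y \<in> \<Omega>}. \<integral>\<^sup>+ x. ennreal (norm (F (Complex x y)) powr p) \<partial>lborel"
  have "?S < \<infinity>" "F holomorphic_on \<Omega>" using assms by (auto simp: hardy_fun_def)
  then have S: "?S = ennreal (enn2real ?S)" by simp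
  show ?thesis
  proof (rule that)
    fix y assume "\<i> * of_real y \<in> \<Omega>"
    then have "(\<integral>\<^sup>+ x. ennreal (norm (F (Complex x y)) powr p) \<partial>lborel) \<le> ?S"
      by (intro SUP_upper) auto
    then show "(\<integral>\<^sup>+ x. ennreal (norm (F (Complex x y)) powr p) \<partial>lborel) \<le> ennreal (enn2real ?S)"
      using S by simp
  qed (use \<open>F holomorphic_on \<Omega>\<close> in auto)
qed

lemma weighted_le_unweighted:
  assumes "Im z \<le> - 1" and "(\<integral>\<^sup>+ x. ennreal (norm (F (Complex x y)) powr p) \<partial>lborel) \<le> ennreal B"
  shows "(\<integral>\<^sup>+ x. ennreal (norm (F (Complex x y)) powr p * cauchy_weight z x) \<partial>lborel) \<le> ennreal B"
proof -
  have "norm (F (Complex x y)) powr p * cauchy_weight z x \<le> norm (F (Complex x y)) powr p" for x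
    using mult_left_mono[OF cauchy_weight_le_1[of z x], of "norm (F (Complex x y)) powr p"] assms by simp
  then have "(\<integral>\<^sup>+ x. ennreal (norm (F (Complex x y)) powr p * cauchy_weight z x) \<partial>lborel)
      \<le> (\<integral>\<^sup>+ x. ennreal (norm (F (Complex x y)) powr p) \<partial>lborel)"
    by (intro nn_integral_mono ennreal_leI)
  then show ?thesis using assms(2) by simp
qed

text \<open>
  Cauchy's formula on a strip around \<open>Im w\<close> expresses \<open>F w\<close> by integrals over two lines. Both the distances to
  these lines and the \<open>L\<^sub>1\<close> bounds on them are independent of \<open>w\<close>.
\<close>
lemma hardy_bounded_away_from_line:
  assumes F: "F holomorphic_on upper_halfplane" and p: "1 < p" and B: "0 \<le> B"
    "\<And>y. 0 < y \<Longrightarrow> (\<integral>\<^sup>+ x. ennreal (norm (F (Complex x y)) powr p) \<partial>lborel) \<le> ennreal B"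
    and d: "0 < d"
  shows "\<exists>M. \<forall>w. d \<le> Im w \<longrightarrow> norm (F w) \<le> M"
proof (intro exI allI impI)
  fix w assume w: "d \<le> Im w"
  \<comment> \<open>A vertical shift by \<open>s\<close> moves \<open>w\<close> to height \<open>d / 2\<close>, and the auxiliary pole \<open>z\<close> stays below it.\<close>
  define s where "s = Im w - d / 2"
  define z where "z = Complex (Re w) (-2)"
  define z0 where "z0 = Complex (Re w) (d / 2)"
  define G where "G = (\<lambda>u. F (u + \<i> * of_real s))"
  define f where "f = (\<lambda>u. G u / (u - z)\<^sup>2)"
  define K where "K = 4 * (kernel_const 2 + B)"
  have K: "0 \<le> K" using B kernel_const_nonneg[of 2] by (simp add: K_def)
  have G: "G holomorphic_on {u. 0 < Im u \<and> Im u < d / 2 + 2}"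
    unfolding G_def using w d
    by (intro holomorphic_on_compose_gen[OF _ F, unfolded o_def] holomorphic_intros) (auto simp: upper_halfplane_def s_def)
  have BG: "(\<integral>\<^sup>+ x. ennreal (norm (G (Complex x y)) powr p * cauchy_weight z x) \<partial>lborel) \<le> ennreal B" if "0 < y" for y
  proof (rule weighted_le_unweighted)
    have "Complex x y + \<i> * of_real s = Complex x (y + s)" for x by (simp add: complex_eq_iff)
    then show "(\<integral>\<^sup>+ x. ennreal (norm (G (Complex x y)) powr p) \<partial>lborel) \<le> ennreal B"
      unfolding G_def using B(2)[of "y + s"] that w d by (simp add: s_def)
  qed (simp add: z_def)
  have f: "f holomorphic_on {u. 0 < Im u \<and> Im u < d / 2 + 2}"
    unfolding f_def by (intro holomorphic_intros G) (auto simp: z_def)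
  have Bf: "(\<integral>\<^sup>+ x. ennreal (norm (f (Complex x y))) \<partial>lborel) \<le> ennreal K" if "0 < y" "y < d / 2 + 2" for y
    unfolding f_def K_def using that B by (intro nn_integral_weighted[OF _ _ p] BG measurable_on_line[OF G]) (auto simp: z_def)
  have line: "norm (LINT x|lborel. f (Complex x c) / (Complex x c - z0)) \<le> K / \<bar>d / 2 - c\<bar>" if "0 < c" "c < d / 2 + 2" "c \<noteq> d / 2" for c
  proof -
    have "norm (LINT x|lborel. f (Complex x c) / (Complex x c - z0)) \<le> max 0 K / \<bar>Im z0 - c\<bar>"
      using that by (intro integrable_line_kernel(3) Bf continuous_on_subset[OF holomorphic_on_imp_continuous_on[OF f]]) (auto simp: z0_def)
    then show ?thesis using K by (simp add: z0_def)
  qed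
  have "2 * pi * norm (f z0) = norm (2 * pi * \<i> * f z0)" by (simp add: norm_mult)
  also have "\<dots> = norm ((LINT x|lborel. f (Complex x (d / 4)) / (Complex x (d / 4) - z0))
      - (LINT x|lborel. f (Complex x (d / 2 + 1)) / (Complex x (d / 2 + 1) - z0)))"
    using d by (subst strip_cauchy_formula[OF f, where B = K]) (auto simp: z0_def intro!: Bf)
  also have "\<dots> \<le> K / \<bar>d / 2 - d / 4\<bar> + K / \<bar>d / 2 - (d / 2 + 1)\<bar>"
    using d by (intro order_trans[OF norm_triangle_ineq4] add_mono line) auto
  also have "\<dots> = K * 4 / d + K" using d by simp
  finally have 1: "norm (f z0) \<le> (K * 4 / d + K) / (2 * pi)"
    by (simp add: field_simps)
  have "z0 + \<i> * of_real s = w" by (simp add: z0_def s_def complex_eq_iff)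
  then have "F w = f z0 * (z0 - z)\<^sup>2"
    by (simp add: f_def G_def) (use d in \<open>simp add: z0_def z_def complex_eq_iff\<close>)
  moreover have "norm (z0 - z) = d / 2 + 2"
    using d by (simp add: z0_def z_def cmod_def)
  ultimately have "norm (F w) = norm (f z0) * (d / 2 + 2)\<^sup>2" by (simp add: norm_mult norm_power)
  also have "\<dots> \<le> (K * 4 / d + K) / (2 * pi) * (d / 2 + 2)\<^sup>2"
    by (intro mult_right_mono 1) auto
  finally show "norm (F w) \<le> (4 * (kernel_const 2 + B) * 4 / d + 4 * (kernel_const 2 + B)) / (2 * pi) * (d / 2 + 2)\<^sup>2"
    by (simp add: K_def)
qed

text \<open>
  The zero function in the lower half-plane continues \<open>D\<close> across the line. In the gluing formula only the line at height
  \<open>Im z + t\<close> contributes, and its contribution is \<open>O(1/t)\<close>.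
\<close>
lemma zero_if_zero_boundary_values:
  assumes D: "D holomorphic_on upper_halfplane" and p: "1 < p"
    and B: "\<And>y. 0 < y \<Longrightarrow> (\<integral>\<^sup>+ x. ennreal (norm (D (Complex x y)) powr p * cauchy_weight (Complex 0 (- 2)) x) \<partial>lborel) \<le> ennreal B" "0 \<le> B"
    and lim: "AE x in lborel. (\<lambda>n. D (Complex x (1 / (real n + 2)))) \<longlonglongrightarrow> 0"
    and z: "z \<in> upper_halfplane"
  shows "D z = 0"
proof (rule ccontr)
  assume "D z \<noteq> 0"
  define N where "N = 2 * pi * norm (D z / (z - Complex 0 (- 2))\<^sup>2)"
  define c where "c = 4 * (kernel_const 2 + B)"
  have c: "0 \<le> c" using B kernel_const_nonneg[of 2] by (simp add: c_def)
  have zpos: "0 < Im z" using z by (simp add: upper_halfplane_def)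
  then have "z - Complex 0 (- 2) \<noteq> 0" by (auto simp: complex_eq_iff)
  then have N: "0 < N" using \<open>D z \<noteq> 0\<close> by (simp add: N_def)
  have "N \<le> c / t" if t: "0 < t" for t
  proof -
    have "N \<le> norm (LINT x|lborel. 0 / (Complex x (-1/2) - Complex 0 (- 2))\<^sup>2 / (Complex x (-1/2) - z)) + c / (Im z + t - Im z)"
      unfolding N_def c_def
    proof (rule glue_weighted_bound(1)[where F = D and z = "Complex 0 (- 2)" and \<zeta> = z and H = "\<lambda>_. 0" and \<alpha> = "-1" and \<beta> = "Im z + t + 1" and u = "\<lambda>_. 0"
            and \<eta> = "\<lambda>n. 1 / (real n + 2)" and a = "-1/2" and b = "Im z + t" and p = p])
      show "D holomorphic_on {w. 0 < Im w \<and> Im w < Im z + t + 1}"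
        by (rule holomorphic_on_subset[OF D]) (auto simp: upper_halfplane_def)
      show "(\<lambda>n. 1 / (real n + 2)) \<longlonglongrightarrow> 0" by real_asymp
      show "1 / (real n + 2) < Im z + t + 1" for n
      proof -
        have "1 / (real n + 2) \<le> 1" by simp
        then show ?thesis using zpos t by linarith
      qed
    qed (use p B lim zpos t in auto)
    then show ?thesis by simp
  qed
  from this[of "(c + 1) / N"] have "N * (c + 1) \<le> c * N"
    using N c by (simp add: field_simps)
  then show False using N by (simp add: algebra_simps)
qed

section \<open>A lower bound near the line implies boundedness\<close>

lemma holomorphic_on_reflect:
  assumes "F holomorphic_on upper_halfplane"
  shows "(\<lambda>w. cnj (F (cnj w))) holomorphic_on lower_halfplane"
proof -
  have "cnj ` lower_halfplane \<subseteq> upper_halfplane" "open lower_halfplane"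
    by (auto simp: lower_halfplane_def upper_halfplane_def open_halfspace_Im_lt)
  then show ?thesis
    using holomorphic_on_compose_cnj_cnj[OF holomorphic_on_subset[OF assms]] by (simp add: o_def)
qed

text \<open>
  The function \<open>H\<close> below continues \<open>F\<close> to the strip under the line, since \<open>g / cnj t = t g = f\<close> almost everywhere on the
  line. Gluing bounds \<open>F\<close> in a thin strip, and farther up \<open>hardy_bounded_away_from_line\<close> applies.
\<close>
lemma model_space_subset_if_lower_bound:
  assumes p: "1 < p" and \<theta>: "inner_function \<theta>" and c: "0 < c" and \<epsilon>: "0 < \<epsilon>"
    and low: "\<And>z. 0 < Im z \<Longrightarrow> Im z < \<epsilon> \<Longrightarrow> c \<le> norm (\<theta> z)"
  shows "model_space p \<theta> \<subseteq> hardy_inf_space upper_halfplane"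
proof
  fix f assume f: "f \<in> model_space p \<theta>"
  from f obtain F where fm: "f \<in> borel_measurable lborel" and F: "F \<in> hardy_fun p upper_halfplane"
    and Ff: "has_boundary_values upper_halfplane F f"
    by (auto simp: model_space_def hardy_space_def Lp_space_def)
  from f obtain t' g G where \<theta>t': "has_boundary_values upper_halfplane \<theta> t'"
    and fg: "AE x in lborel. f x = t' x * g x" and G: "G \<in> hardy_fun p lower_halfplane"
    and Gg: "has_boundary_values lower_halfplane G g"
    by (auto simp: model_space_def hardy_space_def boundary_mult_def)
  from \<theta> obtain t where \<theta>hol: "\<theta> holomorphic_on upper_halfplane" and \<theta>t: "has_boundary_values upper_halfplane \<theta> t"
    and t1: "AE x in lborel. norm (t x) = 1"
    by (auto simp: inner_function_def hardy_inf_fun_def)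
  obtain BF where Fhol: "F holomorphic_on upper_halfplane" and BF: "0 \<le> BF"
    "\<And>y. 0 < y \<Longrightarrow> (\<integral>\<^sup>+ x. ennreal (norm (F (Complex x y)) powr p) \<partial>lborel) \<le> ennreal BF"
    using hardy_funE[OF F] by (auto simp: upper_halfplane_def)
  obtain BG where Ghol: "G holomorphic_on lower_halfplane" and BG: "0 \<le> BG"
    "\<And>y. y < 0 \<Longrightarrow> (\<integral>\<^sup>+ x. ennreal (norm (G (Complex x y)) powr p) \<partial>lborel) \<le> ennreal BG"
    using hardy_funE[OF G] by (auto simp: lower_halfplane_def)
  \<comment> \<open>With \<open>e \<le> 1\<close> the pole at \<open>Re z0 - 2 i\<close> used below is far enough from the strip under the line.\<close>
  define e where "e = min \<epsilon> 1"
  have e: "0 < e" "e \<le> 1" "e \<le> \<epsilon>" using \<epsilon> by (auto simp: e_def)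
  define \<eta> where "\<eta> = (\<lambda>n. e / (real n + 2))"
  have \<eta>: "0 < \<eta> n" "\<eta> n < e" for n
  proof -
    show "0 < \<eta> n" using e by (simp add: \<eta>_def)
    have "e * 1 < e * (real n + 2)" using e by (intro mult_strict_left_mono) auto
    then show "\<eta> n < e" by (simp add: \<eta>_def divide_less_eq)
  qed
  have \<eta>0: "\<eta> \<longlonglongrightarrow> 0" unfolding \<eta>_def by real_asymp
  define H where "H = (\<lambda>w. G w / cnj (\<theta> (cnj w)))"
  have Hhol: "H holomorphic_on {w. - e < Im w \<and> Im w < 0}"
    unfolding H_def
  proof (intro holomorphic_intros holomorphic_on_subset[OF Ghol])
    show "(\<lambda>w. cnj (\<theta> (cnj w))) holomorphic_on {w. - e < Im w \<and> Im w < 0}"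
      using holomorphic_on_reflect[OF \<theta>hol] by (rule holomorphic_on_subset) (auto simp: lower_halfplane_def)
    show "cnj (\<theta> (cnj w)) \<noteq> 0" if "w \<in> {w. - e < Im w \<and> Im w < 0}" for w
      using low[of "cnj w"] that c e by auto
  qed (auto simp: lower_halfplane_def)
  have BH: "(\<integral>\<^sup>+ x. ennreal (norm (H (Complex x y)) powr p) \<partial>lborel) \<le> ennreal ((1 / c) powr p * BG)" if "- e < y" "y < 0" for y
  proof -
    have [measurable]: "(\<lambda>x. G (Complex x y)) \<in> borel_measurable borel"
      using that by (intro measurable_on_line[OF Ghol]) (auto simp: lower_halfplane_def)
    have "(\<integral>\<^sup>+ x. ennreal (norm (H (Complex x y)) powr p) \<partial>lborel) \<le> (\<integral>\<^sup>+ x. ennreal ((1 / c) powr p) * ennreal (norm (G (Complex x y)) powr p) \<partial>lborel)"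
    proof (rule nn_integral_mono)
      fix x
      have "c \<le> norm (\<theta> (cnj (Complex x y)))" using low[of "cnj (Complex x y)"] that e by simp
      then have "norm (H (Complex x y)) \<le> norm (G (Complex x y)) / c"
        unfolding H_def norm_divide complex_mod_cnj using c by (intro divide_left_mono mult_pos_pos) auto
      then have "norm (H (Complex x y)) powr p \<le> (1 / c * norm (G (Complex x y))) powr p"
        using p by (intro powr_mono2) auto
      also have "\<dots> = (1 / c) powr p * norm (G (Complex x y)) powr p"
        by (rule powr_mult)
      finally show "ennreal (norm (H (Complex x y)) powr p) \<le> ennreal ((1 / c) powr p) * ennreal (norm (G (Complex x y)) powr p)"
        by (simp add: ennreal_mult[symmetric] ennreal_leI)
    qed
    also have "\<dots> = ennreal ((1 / c) powr p) * (\<integral>\<^sup>+ x. ennreal (norm (G (Complex x y)) powr p) \<partial>lborel)"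
      by (rule nn_integral_cmult) measurable
    also have "\<dots> \<le> ennreal ((1 / c) powr p) * ennreal BG"
      by (intro mult_left_mono BG that) auto
    also have "\<dots> = ennreal ((1 / c) powr p * BG)" using BG by (simp add: ennreal_mult)
    finally show ?thesis .
  qed
  have Ftof: "AE x in lborel. (\<lambda>n. F (Complex x (\<eta> n))) \<longlonglongrightarrow> f x"
    using \<eta> by (intro boundary_values_vertical[OF Ff _ \<eta>0]) (auto simp: upper_halfplane_def less_imp_neq[THEN not_sym])
  have Htof: "AE x in lborel. (\<lambda>n. H (Complex x (- \<eta> n))) \<longlonglongrightarrow> f x"
  proof -
    have "AE x in lborel. (\<lambda>n. \<theta> (Complex x (\<eta> n))) \<longlonglongrightarrow> t x"
      using \<eta> by (intro boundary_values_vertical[OF \<theta>t _ \<eta>0]) (auto simp: upper_halfplane_def less_imp_neq[THEN not_sym])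
    moreover have "AE x in lborel. (\<lambda>n. \<theta> (Complex x (\<eta> n))) \<longlonglongrightarrow> t' x"
      using \<eta> by (intro boundary_values_vertical[OF \<theta>t' _ \<eta>0]) (auto simp: upper_halfplane_def less_imp_neq[THEN not_sym])
    moreover have "AE x in lborel. (\<lambda>n. G (Complex x (- \<eta> n))) \<longlonglongrightarrow> g x"
      using \<eta> \<eta>0 by (intro boundary_values_vertical[OF Gg] tendsto_eq_intros) (auto simp: lower_halfplane_def less_imp_neq[THEN not_sym])
    ultimately show ?thesis using t1 fg
    proof eventually_elim
      case (elim x)
      have tt: "t' x = t x" using elim(1,2) by (rule LIMSEQ_unique[THEN sym])
      have "t x \<noteq> 0" using elim(4) by auto
      have "(\<lambda>n. G (Complex x (- \<eta> n)) / cnj (\<theta> (Complex x (\<eta> n)))) \<longlonglongrightarrow> g x / cnj (t x)"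
        using \<open>t x \<noteq> 0\<close> by (intro tendsto_intros elim) auto
      moreover have "cnj (Complex x (- \<eta> n)) = Complex x (\<eta> n)" for n by (simp add: complex_eq_iff)
      moreover have "g x / cnj (t x) = f x"
      proof -
        have "t x * cnj (t x) = 1" using elim(4) by (simp add: complex_norm_square[symmetric])
        then show ?thesis using elim(5) tt \<open>t x \<noteq> 0\<close> by (simp add: field_simps)
      qed
      ultimately show ?case by (simp add: H_def)
    qed
  qed
  define B where "B = max BF ((1 / c) powr p * BG)"
  define K where "K = 4 * (kernel_const 2 + B)"
  have B0: "0 \<le> B" using BF by (simp add: B_def)
  have K: "0 \<le> K" using B0 kernel_const_nonneg[of 2] by (simp add: K_def)
  have near: "norm (F z0) \<le> 9 * (6 * K / e) / (2 * pi)" if z0: "0 < Im z0" "Im z0 < e / 4" for z0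
  proof -
    define z where "z = Complex (Re z0) (- 2)"
    define V where "V = norm (LINT x|lborel. H (Complex x (- e / 2)) / (Complex x (- e / 2) - z)\<^sup>2 / (Complex x (- e / 2) - z0))"
    have hyps: "F holomorphic_on {w. 0 < Im w \<and> Im w < e}"
      "Im z \<le> - 1" "Im z / 2 \<le> - e"
      "\<And>y. 0 < y \<Longrightarrow> y < e \<Longrightarrow> (\<integral>\<^sup>+ x. ennreal (norm (F (Complex x y)) powr p * cauchy_weight z x) \<partial>lborel) \<le> ennreal B"
      "\<And>y. - e < y \<Longrightarrow> y < 0 \<Longrightarrow> (\<integral>\<^sup>+ x. ennreal (norm (H (Complex x y)) powr p * cauchy_weight z x) \<partial>lborel) \<le> ennreal B"
      using e by (auto simp: z_def upper_halfplane_def B_def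
          intro!: holomorphic_on_subset[OF Fhol] weighted_le_unweighted
            order_trans[OF BF(2)] order_trans[OF BH] ennreal_leI)
    have pos: "Im z0 < e / 2" "e / 2 < e" "- e < - e / 2" "- e / 2 < 0" "\<And>n. \<eta> n < - (- e)"
      using e z0 \<eta> by auto
    note gl = glue_weighted_bound[OF hyps(1) Hhol p hyps(2-5) B0 \<eta>(1,2) pos(5) \<eta>0 Ftof Htof z0(1) pos(1-4), folded K_def V_def]
    have "2 * pi * norm (F z0 / (z0 - z)\<^sup>2) \<le> V + K / (e / 2 - Im z0)" "V \<le> K / (Im z0 - - e / 2)"
      using gl by simp_all
    moreover have "K / (e / 2 - Im z0) \<le> K / (e / 4)" "K / (Im z0 - - e / 2) \<le> K / (e / 2)"
      using K z0 e by (intro divide_left_mono mult_pos_pos; simp)+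
    ultimately have "2 * pi * norm (F z0 / (z0 - z)\<^sup>2) \<le> 6 * K / e" by simp
    then have 1: "norm (F z0 / (z0 - z)\<^sup>2) \<le> (6 * K / e) / (2 * pi)"
      using mult_imp_le_div_pos[of "2 * pi"] by (metis mult.commute pi_gt_zero mult_pos_pos zero_less_numeral)
    have n: "norm (z0 - z) = Im z0 + 2" using z0 by (simp add: z_def cmod_def)
    have "norm (F z0) = norm (F z0 / (z0 - z)\<^sup>2) * (norm (z0 - z))\<^sup>2"
      using n z0 by (simp add: norm_divide norm_power)
    also have "\<dots> \<le> (6 * K / e) / (2 * pi) * 3\<^sup>2"
      using n z0 e K by (intro mult_mono 1 power_mono) auto
    finally show ?thesis by simp
  qed
  obtain M where M: "\<And>w. e / 4 \<le> Im w \<Longrightarrow> norm (F w) \<le> M"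
    using hardy_bounded_away_from_line[OF Fhol p BF, of "e / 4"] e by auto
  define L where "L = max M (9 * (6 * K / e) / (2 * pi))"
  have L: "norm (F w) \<le> L" if "0 < Im w" for w
    using near[OF that] M[of w] unfolding L_def by (cases "e / 4 \<le> Im w") auto
  have "F \<in> hardy_inf_fun upper_halfplane"
    using Fhol L by (auto simp: hardy_inf_fun_def bounded_iff upper_halfplane_def)
  moreover have "AE x in lborel. norm (f x) \<le> L"
    using Ftof
  proof eventually_elim
    case (elim x)
    show ?case
      by (rule tendsto_upperbound[OF tendsto_norm[OF elim]]) (auto intro!: always_eventually L \<eta>)
  qed
  ultimately show "f \<in> hardy_inf_space upper_halfplane"
    using fm Ff by (auto simp: hardy_inf_space_def Linf_space_def)
qed

text \<open>
  The difference \<open>F - G\<close> has zero boundary values. It need not be in \<open>L\<^sub>p\<close> on the lines, but the weighted bound holds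
  for both terms.
\<close>
lemma hardy_eq_if_boundary_values_eq:
  assumes p: "1 < p" and F: "F \<in> hardy_fun p upper_halfplane" and G: "G \<in> hardy_inf_fun upper_halfplane"
    and bv: "has_boundary_values upper_halfplane F f" "has_boundary_values upper_halfplane G f"
    and z: "z \<in> upper_halfplane"
  shows "F z = G z"
proof -
  let ?\<kappa> = "cauchy_weight (Complex 0 (- 2))"
  obtain B where Fhol: "F holomorphic_on upper_halfplane" and B: "0 \<le> B"
    "\<And>y. 0 < y \<Longrightarrow> (\<integral>\<^sup>+ x. ennreal (norm (F (Complex x y)) powr p) \<partial>lborel) \<le> ennreal B"
    using hardy_funE[OF F] by (auto simp: upper_halfplane_def)
  obtain M where Ghol: "G holomorphic_on upper_halfplane" and M: "\<And>w. 0 < Im w \<Longrightarrow> norm (G w) \<le> M"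
    using G by (auto simp: hardy_inf_fun_def bounded_iff upper_halfplane_def)
  have M0: "0 \<le> M" using order_trans[OF norm_ge_zero M[of \<i>]] by simp
  have "F z - G z = 0"
  proof (rule zero_if_zero_boundary_values[OF _ p _ _ _ z, where D = "\<lambda>w. F w - G w"])
    show "(\<lambda>w. F w - G w) holomorphic_on upper_halfplane"
      by (intro holomorphic_intros Fhol Ghol)
    show "(\<integral>\<^sup>+ x. ennreal (norm (F (Complex x y) - G (Complex x y)) powr p * ?\<kappa> x) \<partial>lborel)
       \<le> ennreal (2 powr p * (B + M powr p * kernel_const 2))" if y: "0 < y" for y
    proof -
      have [measurable]: "(\<lambda>x. F (Complex x y)) \<in> borel_measurable borel"
        using y by (intro measurable_on_line[OF Fhol]) (auto simp: upper_halfplane_def)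
      have "(\<integral>\<^sup>+ x. ennreal (norm (F (Complex x y) - G (Complex x y)) powr p * ?\<kappa> x) \<partial>lborel)
        \<le> (\<integral>\<^sup>+ x. ennreal (2 powr p) * (ennreal (norm (F (Complex x y)) powr p * ?\<kappa> x) + ennreal (M powr p) * ennreal (?\<kappa> x)) \<partial>lborel)"
      proof (rule nn_integral_mono)
        fix x
        let ?a = "norm (F (Complex x y))"
        have "norm (F (Complex x y) - G (Complex x y)) \<le> ?a + M"
          using y by (intro order_trans[OF norm_triangle_ineq4] add_left_mono M) auto
        also have "\<dots> \<le> 2 * max ?a M" by simp
        finally have "norm (F (Complex x y) - G (Complex x y)) powr p \<le> (2 * max ?a M) powr p"
          using p by (intro powr_mono2) auto
        also have "\<dots> = 2 powr p * (max ?a M) powr p" by (rule powr_mult)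
        also have "\<dots> \<le> 2 powr p * (?a powr p + M powr p)" by (auto simp: max_def)
        finally have "norm (F (Complex x y) - G (Complex x y)) powr p * ?\<kappa> x \<le> 2 powr p * (?a powr p + M powr p) * ?\<kappa> x"
          by (intro mult_right_mono cauchy_weight_nonneg)
        then have "ennreal (norm (F (Complex x y) - G (Complex x y)) powr p * ?\<kappa> x) \<le> ennreal (2 powr p * (?a powr p * ?\<kappa> x + M powr p * ?\<kappa> x))"
          by (intro ennreal_leI) (simp add: algebra_simps)
        also have "\<dots> = ennreal (2 powr p) * (ennreal (?a powr p * ?\<kappa> x) + ennreal (M powr p) * ennreal (?\<kappa> x))"
          by (simp add: ennreal_mult cauchy_weight_nonneg)
        finally show "ennreal (norm (F (Complex x y) - G (Complex x y)) powr p * ?\<kappa> x) \<le> \<dots>" .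
      qed
      also have "\<dots> = ennreal (2 powr p) * ((\<integral>\<^sup>+ x. ennreal (norm (F (Complex x y)) powr p * ?\<kappa> x) \<partial>lborel)
           + ennreal (M powr p) * (\<integral>\<^sup>+ x. ennreal (?\<kappa> x) \<partial>lborel))"
        by (simp add: nn_integral_add nn_integral_cmult)
      also have "\<dots> \<le> ennreal (2 powr p) * (ennreal B + ennreal (M powr p) * ennreal (kernel_const 2))"
        by (intro mult_left_mono add_mono weighted_le_unweighted B nn_integral_cauchy_weight y) auto
      also have "\<dots> = ennreal (2 powr p * (B + M powr p * kernel_const 2))"
        using B(1) kernel_const_nonneg[of 2] by (simp add: ennreal_mult)
      finally show ?thesis .
    qed
    show "0 \<le> 2 powr p * (B + M powr p * kernel_const 2)"
      using B(1) kernel_const_nonneg[of 2] by simp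
    have \<eta>: "(\<lambda>n. 1 / (real n + 2)) \<longlonglongrightarrow> 0" by real_asymp
    have "AE x in lborel. (\<lambda>n. F (Complex x (1 / (real n + 2)))) \<longlonglongrightarrow> f x"
      "AE x in lborel. (\<lambda>n. G (Complex x (1 / (real n + 2)))) \<longlonglongrightarrow> f x"
      by (auto intro!: boundary_values_vertical[OF bv(1) _ \<eta>] boundary_values_vertical[OF bv(2) _ \<eta>]
          simp: upper_halfplane_def add_nonneg_eq_0_iff)
    then show "AE x in lborel. (\<lambda>n. F (Complex x (1 / (real n + 2))) - G (Complex x (1 / (real n + 2)))) \<longlonglongrightarrow> 0"
      by eventually_elim (auto intro: tendsto_eq_intros)
  qed
  then show ?thesis by simp
qed

lemma boundary_values_reflect:
  assumes "has_boundary_values upper_halfplane F f"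
  shows "has_boundary_values lower_halfplane (\<lambda>z. cnj (F (cnj z))) (\<lambda>x. cnj (f x))"
  using assms unfolding has_boundary_values_def
proof eventually_elim
  case (elim x)
  show ?case
  proof (intro allI impI tendsto_cnj)
    fix a :: real assume "0 < a"
    have "filterlim cnj (at (complex_of_real x) within stolz_cone upper_halfplane x a)
            (at (complex_of_real x) within stolz_cone lower_halfplane x a)"
      unfolding filterlim_at
    proof
      show "(cnj \<longlongrightarrow> complex_of_real x) (at (complex_of_real x) within stolz_cone lower_halfplane x a)"
        by (rule tendsto_eq_intros | simp)+
      show "\<forall>\<^sub>F z in at (complex_of_real x) within stolz_cone lower_halfplane x a.
            cnj z \<in> stolz_cone upper_halfplane x a \<and> cnj z \<noteq> complex_of_real x"
        unfolding eventually_at_filter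
        by (intro always_eventually) (auto simp: stolz_cone_def upper_halfplane_def lower_halfplane_def complex_eq_iff)
    qed
    then show "((\<lambda>z. F (cnj z)) \<longlongrightarrow> f x) (at (complex_of_real x) within stolz_cone lower_halfplane x a)"
      using elim \<open>0 < a\<close> filterlim_compose by blast
  qed
qed

lemma hardy_fun_reflect:
  assumes "F \<in> hardy_fun p upper_halfplane"
  shows "(\<lambda>z. cnj (F (cnj z))) \<in> hardy_fun p lower_halfplane"
proof -
  obtain B where F: "F holomorphic_on upper_halfplane" and
    B: "\<And>y. 0 < y \<Longrightarrow> (\<integral>\<^sup>+ x. ennreal (norm (F (Complex x y)) powr p) \<partial>lborel) \<le> ennreal B"
    using hardy_funE[OF assms] by (auto simp: upper_halfplane_def)
  have c: "cnj (Complex x y) = Complex x (- y)" for x y by (simp add: complex_eq_iff)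
  have "(SUP y\<in>{y. \<i> * complex_of_real y \<in> lower_halfplane}.
        \<integral>\<^sup>+ x. ennreal (norm (cnj (F (cnj (Complex x y)))) powr p) \<partial>lborel) \<le> ennreal B"
    unfolding complex_mod_cnj c by (intro SUP_least B) (simp add: lower_halfplane_def)
  then show ?thesis
    using holomorphic_on_reflect[OF F] by (auto simp: hardy_fun_def order_le_less_trans)
qed

section \<open>Series of functions dominated by simple poles\<close>

text \<open>
  The modulus of the kernel with pole \<open>cnj l\<close>, normalised so that its \<open>L\<^sub>p\<close> norm does not depend on \<open>l\<close>.
\<close>
definition pole_profile :: "real \<Rightarrow> complex \<Rightarrow> real \<Rightarrow> real" where
  "pole_profile p l x = Im l powr (1 - 1 / p) / norm (Complex x 0 - cnj l)"

text \<open>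
  One integrable function that controls all the normalised kernels at once. Its finiteness at \<open>x\<close> is the only condition on \<open>x\<close>
  that convergence requires, and it replaces Minkowski's inequality and maximal functions.
\<close>
definition pole_majorant :: "real \<Rightarrow> (nat \<Rightarrow> complex) \<Rightarrow> real \<Rightarrow> ennreal" where
  "pole_majorant p l x = (\<Sum>n. ennreal ((1 / 2) ^ n * pole_profile p (l n) x powr p))"

definition pole_weight :: "real \<Rightarrow> complex \<Rightarrow> nat \<Rightarrow> real" where
  "pole_weight p l n = (1 / 4) ^ n * Im l powr (1 - 1 / p)"

lemma pole_profile_measurable [measurable]: "pole_profile p l \<in> borel_measurable borel"
proof -
  have "(\<lambda>x. norm (Complex x 0 - cnj l)) \<in> borel_measurable borel"
    by (intro borel_measurable_continuous_onI continuous_intros)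
  then show ?thesis unfolding pole_profile_def[abs_def] by measurable
qed

lemma pole_profile_nonneg: "0 \<le> pole_profile p l x"
  by (simp add: pole_profile_def)

lemma pole_majorant_measurable [measurable]: "pole_majorant p l \<in> borel_measurable borel"
  unfolding pole_majorant_def[abs_def] by measurable

lemma nn_integral_pole_profile:
  assumes p: "1 < p" and l: "0 < Im l"
  shows "(\<integral>\<^sup>+ x. ennreal (pole_profile p l x powr p) \<partial>lborel) = ennreal (kernel_const p)"
proof -
  have eq: "pole_profile p l x powr p = Im l powr (p - 1) * (1 / norm (Complex (x - Re l) (Im l))) powr p" for x
  proof -
    have "Complex x 0 - cnj l = Complex (x - Re l) (Im l)" by (simp add: complex_eq_iff)
    moreover have "(1 - 1 / p) * p = p - 1" using p by (simp add: field_simps)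
    ultimately show ?thesis
      unfolding pole_profile_def by (simp add: powr_divide powr_powr)
  qed
  have "(\<integral>\<^sup>+ x. ennreal (pole_profile p l x powr p) \<partial>lborel)
     = (\<integral>\<^sup>+ x. ennreal (Im l powr (p - 1)) * ennreal ((1 / norm (Complex (x - Re l) (Im l))) powr p) \<partial>lborel)"
    unfolding eq by (simp add: ennreal_mult)
  also have "\<dots> = ennreal (Im l powr (p - 1)) * ennreal (\<bar>Im l\<bar> powr (1 - p) * kernel_const p)"
    using p l by (subst nn_integral_cmult) (auto simp: nn_integral_kernel)
  also have "\<dots> = ennreal (Im l powr (p - 1) * Im l powr (1 - p) * kernel_const p)"
    using l kernel_const_nonneg[of p] by (simp add: ennreal_mult mult.assoc)
  also have "Im l powr (p - 1) * Im l powr (1 - p) = 1"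
    using l by (simp flip: powr_add)
  finally show ?thesis by simp
qed

lemma nn_integral_pole_majorant:
  assumes p: "1 < p" and l: "\<And>n. 0 < Im (l n)"
  shows "(\<integral>\<^sup>+ x. pole_majorant p l x \<partial>lborel) \<le> ennreal (2 * kernel_const p)"
proof -
  have "(\<integral>\<^sup>+ x. pole_majorant p l x \<partial>lborel) = (\<Sum>n. \<integral>\<^sup>+ x. ennreal ((1 / 2) ^ n * pole_profile p (l n) x powr p) \<partial>lborel)"
    unfolding pole_majorant_def by (subst nn_integral_suminf) auto
  also have "\<dots> = (\<Sum>n. ennreal ((1 / 2) ^ n * kernel_const p))"
  proof (rule suminf_cong)
    fix n
    have "(\<integral>\<^sup>+ x. ennreal ((1 / 2) ^ n * pole_profile p (l n) x powr p) \<partial>lborel)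
       = ennreal ((1 / 2) ^ n) * (\<integral>\<^sup>+ x. ennreal (pole_profile p (l n) x powr p) \<partial>lborel)"
      by (simp add: ennreal_mult nn_integral_cmult)
    also have "\<dots> = ennreal ((1 / 2) ^ n * kernel_const p)"
      using kernel_const_nonneg[of p] by (simp add: ennreal_mult nn_integral_pole_profile p l)
    finally show "(\<integral>\<^sup>+ x. ennreal ((1 / 2) ^ n * pole_profile p (l n) x powr p) \<partial>lborel) = \<dots>" .
  qed
  also have "\<dots> = ennreal (2 * kernel_const p)"
  proof (rule suminf_ennreal_eq)
    have "(\<lambda>n. (1 / 2) ^ n * kernel_const p) sums (2 * kernel_const p)"
      using sums_mult2[OF geometric_sums[of "1 / 2 :: real"], of "kernel_const p"] by simp
    then show "(\<lambda>n. (1 / 2) ^ n * kernel_const p) sums (2 * kernel_const p)" .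
  qed (simp add: kernel_const_nonneg)
  finally show ?thesis by simp
qed

lemma AE_pole_majorant_finite:
  assumes p: "1 < p" and l: "\<And>n. 0 < Im (l n)"
  shows "AE x in lborel. pole_majorant p l x < \<infinity>"
proof -
  have "(\<integral>\<^sup>+ x. pole_majorant p l x \<partial>lborel) \<noteq> \<infinity>"
    using nn_integral_pole_majorant[of p l, OF p l] by (auto simp: top_unique)
  then show ?thesis
    using nn_integral_PInf_AE[of "pole_majorant p l" lborel] by (auto simp: less_top[symmetric])
qed

text \<open>
  A single term of the series for the majorant already gives the bound, because \<open>(2\<^sup>n) powr (1/p) \<le> 2\<^sup>n\<close>.
\<close>
lemma pole_profile_le:
  assumes p: "1 < p" and fin: "pole_majorant p l x < \<infinity>"
  shows "pole_profile p (l n) x \<le> 2 ^ n * enn2real (pole_majorant p l x) powr (1 / p)"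
proof -
  define \<tau> where "\<tau> = enn2real (pole_majorant p l x)"
  define s where "s = pole_profile p (l n) x"
  have s: "0 \<le> s" by (simp add: s_def pole_profile_nonneg)
  have "(\<Sum>i\<in>{n}. ennreal ((1 / 2) ^ i * pole_profile p (l i) x powr p)) \<le> pole_majorant p l x"
    unfolding pole_majorant_def by (rule sum_le_suminf) auto
  then have "ennreal ((1 / 2) ^ n * s powr p) \<le> pole_majorant p l x"
    unfolding s_def by (simp only: sum.insert sum.empty finite.emptyI empty_iff not_False_eq_True add_0_right)
  also have "\<dots> = ennreal \<tau>" using fin by (simp add: \<tau>_def)
  finally have "(1 / 2) ^ n * s powr p \<le> \<tau>"
    by (rule ennreal_le_iff[THEN iffD1, rotated]) (simp add: \<tau>_def)
  then have "2 ^ n * ((1 / 2) ^ n * s powr p) \<le> 2 ^ n * \<tau>" by (rule mult_left_mono) simp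
  moreover have "2 ^ n * ((1 / 2) ^ n * s powr p) = s powr p"
    by (simp flip: mult.assoc power_mult_distrib)
  ultimately have 1: "s powr p \<le> 2 ^ n * \<tau>" by simp
  have "s = (s powr p) powr (1 / p)" using s p by (simp add: powr_powr)
  also have "\<dots> \<le> (2 ^ n * \<tau>) powr (1 / p)" using 1 p by (intro powr_mono2) auto
  also have "\<dots> = (2 ^ n) powr (1 / p) * \<tau> powr (1 / p)" by (rule powr_mult)
  also have "\<dots> \<le> 2 ^ n * \<tau> powr (1 / p)"
  proof (intro mult_right_mono)
    have "(2 ^ n :: real) powr (1 / p) \<le> (2 ^ n) powr 1" using p by (intro powr_mono) auto
    then show "(2 ^ n :: real) powr (1 / p) \<le> 2 ^ n" by simp
  qed simp
  finally show ?thesis by (simp add: s_def \<tau>_def)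
qed

text \<open>
  The weights \<open>4\<^sup>-\<^sup>n\<close> outweigh the loss \<open>2\<^sup>n\<close> in \<open>pole_profile_le\<close>, so a geometric series remains.
\<close>
lemma series_le_majorant:
  fixes v :: "nat \<Rightarrow> complex"
  assumes p: "1 < p" and fin: "pole_majorant p l x < \<infinity>" and C: "0 \<le> C"
    and v: "\<And>n. norm (v n) \<le> C * ((1 / 4) ^ n * pole_profile p (l n) x)"
  shows "summable v" and "norm (suminf v) powr p \<le> (2 * C) powr p * enn2real (pole_majorant p l x)"
proof -
  define \<tau> where "\<tau> = enn2real (pole_majorant p l x) powr (1 / p)"
  have le: "norm (v n) \<le> (C * \<tau>) * (1 / 2) ^ n" for n
  proof -
    have "norm (v n) \<le> C * ((1 / 4) ^ n * (2 ^ n * \<tau>))"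
      using pole_profile_le[OF p fin, of n] C
      by (intro order_trans[OF v] mult_left_mono) (auto simp: \<tau>_def)
    also have "\<dots> = C * \<tau> * ((1 / 4) ^ n * 2 ^ n)" by simp
    also have "(1 / 4) ^ n * 2 ^ n = (1 / 2 :: real) ^ n"
      by (simp flip: power_mult_distrib)
    finally show ?thesis .
  qed
  have sum: "(\<lambda>n. (C * \<tau>) * (1 / 2) ^ n) sums (C * \<tau> * 2)"
    using sums_mult[OF geometric_sums[of "1 / 2 :: real"], of "C * \<tau>"] by simp
  have sn: "summable (\<lambda>n. norm (v n))"
    using le by (intro summable_comparison_test'[OF sums_summable[OF sum], of 0]) auto
  then show "summable v" by (rule summable_norm_cancel)
  have "norm (suminf v) \<le> (\<Sum>n. norm (v n))" by (rule summable_norm[OF sn])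
  also have "\<dots> \<le> C * \<tau> * 2"
    unfolding sums_unique[OF sum] by (rule suminf_le[OF le sn sums_summable[OF sum]])
  finally have "norm (suminf v) powr p \<le> (2 * C * \<tau>) powr p"
    using p by (intro powr_mono2) (auto simp: mult_ac)
  also have "\<dots> = (2 * C) powr p * \<tau> powr p" by (rule powr_mult)
  also have "\<tau> powr p = enn2real (pole_majorant p l x)"
    using p by (simp add: \<tau>_def powr_powr)
  finally show "norm (suminf v) powr p \<le> (2 * C) powr p * enn2real (pole_majorant p l x)" .
qed

lemma dist_pole_ge:
  assumes "0 < Im l" "0 < Im z"
  shows "Im z \<le> norm (z - cnj l)" "Im l \<le> norm (z - cnj l)" "norm (Complex (Re z) 0 - cnj l) \<le> norm (z - cnj l)"
proof -
  show "Im z \<le> norm (z - cnj l)" "Im l \<le> norm (z - cnj l)"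
    using abs_Im_le_cmod[of "z - cnj l"] assms by auto
  have "(Im l)\<^sup>2 \<le> (Im z + Im l)\<^sup>2" using assms by (intro power_mono) auto
  then show "norm (Complex (Re z) 0 - cnj l) \<le> norm (z - cnj l)"
    by (simp add: cmod_def)
qed

text \<open>
  Each term is dominated by a normalised kernel at the boundary point \<open>x\<close>, both on the vertical line through \<open>x\<close> and, up to the
  factor \<open>a + 2\<close>, in the Stolz cone of aperture \<open>a\<close>: there \<open>|x - z| \<le> (a + 1) Im z\<close>, and \<open>Im z\<close> is at most the
  distance from \<open>z\<close> to the pole. Hence the majorant bounds the norms on the lines, and wherever it is finite
  the boundary limits may be taken term by term.
\<close>
lemma pole_series:
  fixes h :: "nat \<Rightarrow> complex \<Rightarrow> complex" and u :: "nat \<Rightarrow> real \<Rightarrow> complex"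
  assumes p: "1 < p" and l: "\<And>n. 0 < Im (l n)" "\<And>n. Im (l n) \<le> 1" and C: "0 < C"
    and hol: "\<And>n. h n holomorphic_on upper_halfplane"
    and h: "\<And>n z. 0 < Im z \<Longrightarrow> norm (h n z) \<le> C / norm (z - cnj (l n))"
    and bv: "\<And>n. has_boundary_values upper_halfplane (h n) (u n)"
    and [measurable]: "\<And>n. u n \<in> borel_measurable borel"
  defines "F \<equiv> (\<lambda>z. \<Sum>n. of_real (pole_weight p (l n) n) * h n z)"
    and "f \<equiv> (\<lambda>x. \<Sum>n. of_real (pole_weight p (l n) n) * u n x)"
  shows "F \<in> hardy_fun p upper_halfplane" and "f \<in> Lp_space p" and "has_boundary_values upper_halfplane F f"
    and "AE x in lborel. summable (\<lambda>n. of_real (pole_weight p (l n) n) * u n x)"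
    and "\<And>z. 0 < Im z \<Longrightarrow> summable (\<lambda>n. of_real (pole_weight p (l n) n) * h n z)"
proof -
  let ?w = "\<lambda>n. pole_weight p (l n) n"
  have w0: "0 \<le> ?w n" for n by (simp add: pole_weight_def)
  have w1: "?w n \<le> (1 / 4) ^ n" for n
  proof -
    have "Im (l n) powr (1 - 1 / p) \<le> 1" using l[of n] p by (intro powr_le1) auto
    then show ?thesis
      unfolding pole_weight_def using mult_left_mono[of _ 1 "(1 / 4 :: real) ^ n"] by simp
  qed
  have wprof: "?w n * (C / norm (Complex x 0 - cnj (l n))) = C * ((1 / 4) ^ n * pole_profile p (l n) x)" for n x
    by (simp add: pole_weight_def pole_profile_def)
  have geo: "summable (\<lambda>n. (1 / 4) ^ n * (C / \<delta>))" for \<delta>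
    by (intro summable_mult2 summable_geometric) simp
  have term_le: "norm (of_real (?w n) * h n z) \<le> (1 / 4) ^ n * (C / \<delta>)" if "0 < \<delta>" "\<delta> \<le> Im z" for n z \<delta>
  proof -
    have "\<delta> \<le> norm (z - cnj (l n))" using dist_pole_ge(1)[of "l n" z] l that by auto
    then have "C / norm (z - cnj (l n)) \<le> C / \<delta>"
      using C that by (intro divide_left_mono mult_pos_pos) auto
    then have "norm (h n z) \<le> C / \<delta>" using h[of z n] that by auto
    then show ?thesis
      unfolding norm_mult using w0[of n] w1[of n] by (intro mult_mono) auto
  qed
  show summ: "summable (\<lambda>n. of_real (?w n) * h n z)" if "0 < Im z" for z
    using term_le[OF that order_refl] by (intro summable_comparison_test'[OF geo[of "Im z"], of 0]) auto
  have Fhol: "F holomorphic_on upper_halfplane"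
  proof (rule holomorphic_uniform_sequence[where f = "\<lambda>N z. \<Sum>n<N. of_real (?w n) * h n z"])
    show "open upper_halfplane" by (simp add: upper_halfplane_def open_halfspace_Im_gt)
    show "(\<lambda>z. \<Sum>n<N. of_real (?w n) * h n z) holomorphic_on upper_halfplane" for N
      by (intro holomorphic_intros hol)
    fix z assume "z \<in> upper_halfplane"
    then have z: "0 < Im z" by (simp add: upper_halfplane_def)
    have Im: "Im z / 2 \<le> Im y" if "y \<in> cball z (Im z / 2)" for y
      using that abs_Im_le_cmod[of "z - y"] by (simp add: dist_norm)
    show "\<exists>d>0. cball z d \<subseteq> upper_halfplane \<and>
      uniform_limit (cball z d) (\<lambda>N z. \<Sum>n<N. of_real (?w n) * h n z) F sequentially"
    proof (intro exI[of _ "Im z / 2"] conjI)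
      show "cball z (Im z / 2) \<subseteq> upper_halfplane"
        using Im z by (fastforce simp: upper_halfplane_def)
      show "uniform_limit (cball z (Im z / 2)) (\<lambda>N z. \<Sum>n<N. of_real (?w n) * h n z) F sequentially"
        unfolding F_def using Im z
        by (intro Weierstrass_m_test[OF _ geo[of "Im z / 2"]] term_le) auto
    qed (use z in simp)
  qed
  have Fbound: "ennreal (norm (F (Complex x y)) powr p) \<le> ennreal ((2 * C) powr p) * pole_majorant p l x" if y: "0 < y" for x y
  proof (cases "pole_majorant p l x < \<infinity>")
    case True
    have "norm (F (Complex x y)) powr p \<le> (2 * C) powr p * enn2real (pole_majorant p l x)"
      unfolding F_def
    proof (rule series_le_majorant(2)[OF p True])
      fix n
      have nz: "0 < norm (Complex x 0 - cnj (l n))" using l(1)[of n] by (auto simp: complex_eq_iff)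
      have "norm (of_real (?w n) * h n (Complex x y)) \<le> ?w n * (C / norm (Complex x y - cnj (l n)))"
        unfolding norm_mult using w0[of n] y by (intro mult_mono h) auto
      also have "\<dots> \<le> ?w n * (C / norm (Complex x 0 - cnj (l n)))"
        using dist_pole_ge(3)[of "l n" "Complex x y"] l(1) y C nz
        by (intro mult_left_mono divide_left_mono mult_pos_pos w0) auto
      finally show "norm (of_real (?w n) * h n (Complex x y)) \<le> C * ((1 / 4) ^ n * pole_profile p (l n) x)"
        unfolding wprof .
    qed (use C in simp)
    then have "ennreal (norm (F (Complex x y)) powr p) \<le> ennreal ((2 * C) powr p * enn2real (pole_majorant p l x))"
      by (rule ennreal_leI)
    then show ?thesis using True by (simp add: ennreal_mult)
  next
    case False
    then have "pole_majorant p l x = top" by (simp add: less_top[symmetric])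
    then show ?thesis using C by (simp add: ennreal_mult_top)
  qed
  have majint: "(\<integral>\<^sup>+ x. ennreal ((2 * C) powr p) * pole_majorant p l x \<partial>lborel) \<le> ennreal ((2 * C) powr p * (2 * kernel_const p))"
  proof -
    have "(\<integral>\<^sup>+ x. ennreal ((2 * C) powr p) * pole_majorant p l x \<partial>lborel) = ennreal ((2 * C) powr p) * (\<integral>\<^sup>+ x. pole_majorant p l x \<partial>lborel)"
      by (rule nn_integral_cmult) simp
    also have "\<dots> \<le> ennreal ((2 * C) powr p) * ennreal (2 * kernel_const p)"
      by (intro mult_left_mono nn_integral_pole_majorant p l) auto
    finally show ?thesis by (simp add: ennreal_mult[symmetric] kernel_const_nonneg)
  qed
  show "F \<in> hardy_fun p upper_halfplane"
  proof -
    have "(SUP y\<in>{y. \<i> * of_real y \<in> upper_halfplane}. \<integral>\<^sup>+ x. ennreal (norm (F (Complex x y)) powr p) \<partial>lborel)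
       \<le> ennreal ((2 * C) powr p * (2 * kernel_const p))"
    proof (rule SUP_least)
      fix y assume "y \<in> {y. \<i> * of_real y \<in> upper_halfplane}"
      then have "0 < y" by (simp add: upper_halfplane_def)
      then have "(\<integral>\<^sup>+ x. ennreal (norm (F (Complex x y)) powr p) \<partial>lborel) \<le> (\<integral>\<^sup>+ x. ennreal ((2 * C) powr p) * pole_majorant p l x \<partial>lborel)"
        by (intro nn_integral_mono Fbound)
      then show "(\<integral>\<^sup>+ x. ennreal (norm (F (Complex x y)) powr p) \<partial>lborel) \<le> ennreal ((2 * C) powr p * (2 * kernel_const p))"
        using majint by (rule order_trans)
    qed
    then show ?thesis
      using Fhol by (auto simp: hardy_fun_def order_le_less_trans)
  qed
  have good: "AE x in lborel. pole_majorant p l x < \<infinity> \<and> (\<forall>n. \<forall>a>0. (h n \<longlongrightarrow> u n x) (at (of_real x) within stolz_cone upper_halfplane x a))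
      \<and> (\<forall>n. norm (u n x) \<le> C / norm (Complex x 0 - cnj (l n)))"
  proof -
    have \<eta>: "(\<lambda>n. 1 / (real n + 1)) \<longlonglongrightarrow> 0" by real_asymp
    have "AE x in lborel. \<forall>n. \<forall>a>0. (h n \<longlongrightarrow> u n x) (at (of_real x) within stolz_cone upper_halfplane x a)"
      using bv by (simp add: AE_all_countable has_boundary_values_def)
    moreover have "AE x in lborel. \<forall>n. (\<lambda>k. h n (Complex x (1 / (real k + 1)))) \<longlonglongrightarrow> u n x"
      unfolding AE_all_countable
      by (auto intro!: boundary_values_vertical[OF bv _ \<eta>] simp: upper_halfplane_def add_nonneg_eq_0_iff)
    moreover have "AE x in lborel. pole_majorant p l x < \<infinity>"
      by (rule AE_pole_majorant_finite) (use p l in auto)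
    ultimately show ?thesis
    proof eventually_elim
      case (elim x)
      have "norm (u n x) \<le> C / norm (Complex x 0 - cnj (l n))" for n
      proof (rule tendsto_upperbound)
        show "(\<lambda>k. norm (h n (Complex x (1 / (real k + 1))))) \<longlonglongrightarrow> norm (u n x)"
          using elim(2) by (intro tendsto_norm) auto
        have nz: "0 < norm (Complex x 0 - cnj (l n))" using l(1)[of n] by (auto simp: complex_eq_iff)
        show "\<forall>\<^sub>F k in sequentially. norm (h n (Complex x (1 / (real k + 1)))) \<le> C / norm (Complex x 0 - cnj (l n))"
        proof (rule always_eventually, rule allI)
          fix k
          have pos: "0 < 1 / (real k + 1)" by simp
          have "norm (h n (Complex x (1 / (real k + 1)))) \<le> C / norm (Complex x (1 / (real k + 1)) - cnj (l n))"
            using pos by (intro h) simp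
          also have "\<dots> \<le> C / norm (Complex x 0 - cnj (l n))"
            using dist_pole_ge(3)[of "l n" "Complex x (1 / (real k + 1))"] l(1)[of n] C nz pos
            by (intro divide_left_mono mult_pos_pos) auto
          finally show "norm (h n (Complex x (1 / (real k + 1)))) \<le> C / norm (Complex x 0 - cnj (l n))" .
        qed
      qed simp
      then show ?case using elim by blast
    qed
  qed
  have uterm: "norm (of_real (?w n) * u n x) \<le> C * ((1 / 4) ^ n * pole_profile p (l n) x)"
    if "norm (u n x) \<le> C / norm (Complex x 0 - cnj (l n))" for n x
    using mult_left_mono[OF that w0[of n]] w0[of n] unfolding wprof by (simp add: norm_mult)
  show "AE x in lborel. summable (\<lambda>n. of_real (?w n) * u n x)"
    using good
  proof eventually_elim
    case (elim x)
    then show ?case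
      using C uterm by (intro series_le_majorant(1)[OF p, of l x C]) auto
  qed
  show "f \<in> Lp_space p"
  proof -
    have [measurable]: "f \<in> borel_measurable borel"
      unfolding f_def by measurable
    have "AE x in lborel. ennreal (norm (f x) powr p) \<le> ennreal ((2 * C) powr p) * pole_majorant p l x"
      using good
    proof eventually_elim
      case (elim x)
      have "norm (f x) powr p \<le> (2 * C) powr p * enn2real (pole_majorant p l x)"
        unfolding f_def using C elim uterm by (intro series_le_majorant(2)[OF p, of l x C]) auto
      then have "ennreal (norm (f x) powr p) \<le> ennreal ((2 * C) powr p * enn2real (pole_majorant p l x))"
        by (rule ennreal_leI)
      then show ?case using elim by (simp add: ennreal_mult)
    qed
    then have "(\<integral>\<^sup>+ x. ennreal (norm (f x) powr p) \<partial>lborel) \<le> (\<integral>\<^sup>+ x. ennreal ((2 * C) powr p) * pole_majorant p l x \<partial>lborel)"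
      by (rule nn_integral_mono_AE)
    also note majint
    finally have "(\<integral>\<^sup>+ x. ennreal (norm (f x) powr p) \<partial>lborel) < \<infinity>"
      by (simp add: order_le_less_trans)
    then have "integrable lborel (\<lambda>x. norm (f x) powr p)"
      by (intro integrableI_bounded) auto
    then show ?thesis by (simp add: Lp_space_def)
  qed
  show "has_boundary_values upper_halfplane F f"
    unfolding has_boundary_values_def
    using good
  proof eventually_elim
    case (elim x)
    show ?case
    proof (intro allI impI)
      fix a :: real assume a: "0 < a"
      define \<F> where "\<F> = at (complex_of_real x) within stolz_cone upper_halfplane x a"
      define \<tau> where "\<tau> = enn2real (pole_majorant p l x) powr (1 / p)"
      have key: "norm (of_real (?w n) * h n z) \<le> (a + 2) * C * \<tau> * (1 / 2) ^ n" if z: "z \<in> stolz_cone upper_halfplane x a" for n z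
      proof -
        have zI: "0 < Im z" and zR: "\<bar>Re z - x\<bar> < a * Im z"
          using z by (auto simp: stolz_cone_def upper_halfplane_def)
        let ?d = "norm (z - cnj (l n))" and ?e = "norm (Complex x 0 - cnj (l n))"
        have d: "Im z \<le> ?d" "0 < ?d" using dist_pole_ge(1)[of "l n" z] l zI by auto
        have e: "0 < ?e" using l(1)[of n] by (auto simp: complex_eq_iff)
        have "norm (Complex x 0 - z) \<le> \<bar>Re (Complex x 0 - z)\<bar> + \<bar>Im (Complex x 0 - z)\<bar>" by (rule cmod_le)
        also have "\<dots> \<le> (a + 1) * Im z" using zI zR by (simp add: algebra_simps)
        also have "\<dots> \<le> (a + 1) * ?d" using a d by (intro mult_left_mono) auto
        finally have "?e \<le> (a + 2) * ?d"
          using norm_triangle_ineq[of "Complex x 0 - z" "z - cnj (l n)"] by (simp add: algebra_simps)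
        then have "C / ?d \<le> (a + 2) * (C / ?e)"
          using C d e a mult_left_mono[of ?e "(a + 2) * ?d" C] by (simp add: field_simps)
        then have "norm (of_real (?w n) * h n z) \<le> ?w n * ((a + 2) * (C / ?e))"
          unfolding norm_mult using w0[of n] h[OF zI, of n] by (intro mult_mono) auto
        also have "\<dots> = (a + 2) * (C * ((1 / 4) ^ n * pole_profile p (l n) x))"
          unfolding wprof[symmetric] by simp
        also have "\<dots> \<le> (a + 2) * (C * ((1 / 4) ^ n * (2 ^ n * \<tau>)))"
          using pole_profile_le[OF p, of l x n] elim a C unfolding \<tau>_def by (intro mult_left_mono) auto
        also have "\<dots> = (a + 2) * C * \<tau> * ((1 / 4) ^ n * 2 ^ n)" by simp
        also have "(1 / 4) ^ n * 2 ^ n = (1 / 2 :: real) ^ n" by (simp flip: power_mult_distrib)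
        finally show ?thesis .
      qed
      show "(F \<longlongrightarrow> f x) \<F>"
      proof (cases "\<F> = bot")
        case False
        have "\<forall>\<^sub>F z in \<F>. z \<in> stolz_cone upper_halfplane x a"
          unfolding \<F>_def by (simp add: eventually_at_filter)
        then have ev: "\<forall>\<^sub>F z in \<F>. \<forall>n. norm (of_real (?w n) * h n z) \<le> (a + 2) * C * \<tau> * (1 / 2) ^ n"
          by eventually_elim (use key in blast)
        have "\<forall>\<^sub>F (n, z) in at_top \<times>\<^sub>F \<F>. norm (of_real (?w n) * h n z) \<le> (a + 2) * C * \<tau> * (1 / 2) ^ n"
          unfolding eventually_prod_filter
          by (intro exI[of _ "\<lambda>_. True"] exI[of _ "\<lambda>z. \<forall>n. norm (of_real (?w n) * h n z) \<le> (a + 2) * C * \<tau> * (1 / 2) ^ n"]) (use ev in auto)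
        moreover have "summable (\<lambda>n. (a + 2) * C * \<tau> * (1 / 2) ^ n)"
          by (intro summable_mult summable_geometric) simp
        moreover have "((\<lambda>z. of_real (?w n) * h n z) \<longlongrightarrow> of_real (?w n) * u n x) \<F>" for n
          unfolding \<F>_def using elim a by (intro tendsto_mult tendsto_const) auto
        ultimately show ?thesis
          unfolding F_def f_def using False
            tannerys_theorem[of "\<lambda>n z. of_real (?w n) * h n z" "\<lambda>n. of_real (?w n) * u n x" \<F> "\<lambda>n. (a + 2) * C * \<tau> * (1 / 2) ^ n"]
          by blast
      qed simp
    qed
  qed
qed

section \<open>Model space elements from reproducing kernels\<close>

lemma reproducing_kernel_term:
  assumes hol: "\<theta> holomorphic_on upper_halfplane" and M: "\<And>z. 0 < Im z \<Longrightarrow> norm (\<theta> z) \<le> M"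
    and l: "0 < Im l" and \<theta>t: "has_boundary_values upper_halfplane \<theta> t"
  shows "(\<lambda>z. (1 - cnj (\<theta> l) * \<theta> z) / (z - cnj l)) holomorphic_on upper_halfplane"
    and "0 < Im z \<Longrightarrow> norm ((1 - cnj (\<theta> l) * \<theta> z) / (z - cnj l)) \<le> (1 + M * M) / norm (z - cnj l)"
    and "has_boundary_values upper_halfplane (\<lambda>z. (1 - cnj (\<theta> l) * \<theta> z) / (z - cnj l))
           (\<lambda>x. (1 - cnj (\<theta> l) * t x) / (of_real x - cnj l))"
proof -
  show "(\<lambda>z. (1 - cnj (\<theta> l) * \<theta> z) / (z - cnj l)) holomorphic_on upper_halfplane"
    using l by (intro holomorphic_intros hol) (auto simp: upper_halfplane_def)
  show "norm ((1 - cnj (\<theta> l) * \<theta> z) / (z - cnj l)) \<le> (1 + M * M) / norm (z - cnj l)" if "0 < Im z"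
  proof -
    have "norm (1 - cnj (\<theta> l) * \<theta> z) \<le> 1 + norm (\<theta> l) * norm (\<theta> z)"
      using norm_triangle_ineq4[of 1 "cnj (\<theta> l) * \<theta> z"] by (simp add: norm_mult)
    also have "\<dots> \<le> 1 + M * M"
      using M[OF l] M[OF that] order_trans[OF norm_ge_zero M[OF l]] by (intro add_left_mono mult_mono) auto
    finally show ?thesis unfolding norm_divide by (intro divide_right_mono) auto
  qed
  show "has_boundary_values upper_halfplane (\<lambda>z. (1 - cnj (\<theta> l) * \<theta> z) / (z - cnj l))
           (\<lambda>x. (1 - cnj (\<theta> l) * t x) / (of_real x - cnj l))"
    using \<theta>t unfolding has_boundary_values_def
  proof eventually_elim
    case (elim x)
    have "of_real x - cnj l \<noteq> 0" using l by (auto simp: complex_eq_iff)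
    then show ?case using elim by (auto intro!: tendsto_intros)
  qed
qed

text \<open>
  On the line \<open>(t - \<theta> l) / (x - l)\<close> is the conjugate of the boundary function of the reproducing kernel at \<open>l\<close>, divided by
  \<open>t\<close>. This is how the factor in the lower half-plane arises.
\<close>
definition difference_quotient :: "(complex \<Rightarrow> complex) \<Rightarrow> complex \<Rightarrow> complex \<Rightarrow> complex" where
  "difference_quotient \<theta> l z = (if z = l then deriv \<theta> l else (\<theta> z - \<theta> l) / (z - l))"

text \<open>
  Outside the disc of radius \<open>Im l / 2\<close> about \<open>l\<close> the distances to \<open>l\<close> and to \<open>cnj l\<close> are comparable. Inside, the maximum
  principle reduces the estimate to the bounding circle. So the removable singularity at \<open>l\<close> may be traded for a pole at
  \<open>cnj l\<close>, as \<open>pole_series\<close> demands.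
\<close>
lemma difference_quotient_term:
  assumes hol: "\<theta> holomorphic_on upper_halfplane" and M: "\<And>z. 0 < Im z \<Longrightarrow> norm (\<theta> z) \<le> M"
    and l: "0 < Im l" and \<theta>t: "has_boundary_values upper_halfplane \<theta> t"
  shows "difference_quotient \<theta> l holomorphic_on upper_halfplane"
    and "0 < Im z \<Longrightarrow> norm (difference_quotient \<theta> l z) \<le> 10 * M / norm (z - cnj l)"
    and "has_boundary_values upper_halfplane (difference_quotient \<theta> l) (\<lambda>x. (t x - \<theta> l) / (of_real x - l))"
proof -
  have op: "open upper_halfplane" by (simp add: upper_halfplane_def open_halfspace_Im_gt)
  show qhol: "difference_quotient \<theta> l holomorphic_on upper_halfplane"
    unfolding difference_quotient_def[abs_def]
    using op l by (intro pole_lemma hol) (simp add: interior_open upper_halfplane_def)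
  have M0: "0 \<le> M" using order_trans[OF norm_ge_zero M[OF l]] .
  have far: "norm (difference_quotient \<theta> l z) \<le> 2 * M / norm (z - l)" if "0 < Im z" "z \<noteq> l" for z
  proof -
    have "norm (\<theta> z - \<theta> l) \<le> M + M"
      using M[OF that(1)] M[OF l] by (intro order_trans[OF norm_triangle_ineq4] add_mono)
    then show ?thesis using that by (simp add: difference_quotient_def norm_divide divide_right_mono)
  qed
  define r where "r = Im l / 2"
  have r: "0 < r" using l by (simp add: r_def)
  have sub: "cball l r \<subseteq> upper_halfplane"
  proof
    fix z assume "z \<in> cball l r"
    then have "\<bar>Im (l - z)\<bar> \<le> r" using abs_Im_le_cmod[of "l - z"] by (simp add: dist_norm)
    then show "z \<in> upper_halfplane"
      using l abs_ge_self[of "Im (l - z)"] unfolding upper_halfplane_def r_def by simp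
  qed
  have near: "norm (difference_quotient \<theta> l z) \<le> 2 * M / r" if z: "z \<in> cball l r" for z
  proof (rule maximum_modulus_frontier[where S = "cball l r" and f = "difference_quotient \<theta> l" and \<xi> = z])
    show "difference_quotient \<theta> l holomorphic_on interior (cball l r)"
      using sub by (intro holomorphic_on_subset[OF qhol]) auto
    show "continuous_on (closure (cball l r)) (difference_quotient \<theta> l)"
      using sub by (intro continuous_on_subset[OF holomorphic_on_imp_continuous_on[OF qhol]]) auto
    fix w assume "w \<in> frontier (cball l r)"
    then have "norm (w - l) = r" using r by (simp add: frontier_def dist_norm norm_minus_commute)
    moreover have "w \<in> cball l r" using \<open>norm (w - l) = r\<close> by (simp add: dist_norm norm_minus_commute)
    ultimately show "norm (difference_quotient \<theta> l w) \<le> 2 * M / r"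
      using far[of w] sub r by (auto simp: upper_halfplane_def)
  qed (use z in auto)
  show "norm (difference_quotient \<theta> l z) \<le> 10 * M / norm (z - cnj l)" if z: "0 < Im z"
  proof -
    have d: "0 < norm (z - cnj l)" using z l by (auto simp: complex_eq_iff)
    have "norm (l - cnj l) = 2 * Im l" using l by (simp add: complex_diff_cnj norm_mult)
    then have tri: "norm (z - cnj l) \<le> norm (z - l) + 4 * r"
      using norm_triangle_ineq[of "z - l" "l - cnj l"] by (simp add: r_def)
    show ?thesis
    proof (cases "z \<in> cball l r")
      case True
      then have "norm (z - l) \<le> r" by (simp add: dist_norm norm_minus_commute)
      then have "norm (z - cnj l) \<le> 5 * r" using tri by simp
      then have "2 * M * norm (z - cnj l) \<le> 2 * M * (5 * r)" using M0 by (intro mult_left_mono) auto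
      then have "2 * M / r \<le> 10 * M / norm (z - cnj l)"
        using d r by (simp add: divide_le_eq le_divide_eq mult_ac)
      then show ?thesis using near[OF True] by simp
    next
      case False
      then have zl: "r < norm (z - l)" by (simp add: dist_norm norm_minus_commute)
      then have "norm (z - cnj l) \<le> 5 * norm (z - l)" using tri by simp
      then have "2 * M * norm (z - cnj l) \<le> 2 * M * (5 * norm (z - l))" using M0 by (intro mult_left_mono) auto
      moreover have pos: "0 < norm (z - l)" using zl r by linarith
      ultimately have "2 * M / norm (z - l) \<le> 10 * M / norm (z - cnj l)"
        using d by (simp add: divide_le_eq le_divide_eq mult_ac)
      moreover have "z \<noteq> l" using pos by auto
      ultimately show ?thesis using far[OF z] by simp
    qed
  qed
  show "has_boundary_values upper_halfplane (difference_quotient \<theta> l) (\<lambda>x. (t x - \<theta> l) / (of_real x - l))"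
    using \<theta>t unfolding has_boundary_values_def
  proof eventually_elim
    case (elim x)
    have nz: "of_real x - l \<noteq> 0" using l by (auto simp: complex_eq_iff)
    show ?case
    proof (intro allI impI)
      fix a :: real assume "0 < a"
      have "((\<lambda>z. (\<theta> z - \<theta> l) / (z - l)) \<longlongrightarrow> (t x - \<theta> l) / (of_real x - l)) (at (of_real x) within stolz_cone upper_halfplane x a)"
        using nz elim \<open>0 < a\<close> by (auto intro!: tendsto_intros)
      moreover have "\<forall>\<^sub>F z in at (of_real x) within stolz_cone upper_halfplane x a. z \<noteq> l"
        using nz tendsto_ident_at[of "of_real x" "stolz_cone upper_halfplane x a"]
        by (intro tendsto_imp_eventually_ne) auto
      then have "\<forall>\<^sub>F z in at (of_real x) within stolz_cone upper_halfplane x a. (\<theta> z - \<theta> l) / (z - l) = difference_quotient \<theta> l z"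
        by eventually_elim (simp add: difference_quotient_def)
      ultimately show "(difference_quotient \<theta> l \<longlongrightarrow> (t x - \<theta> l) / (of_real x - l)) (at (of_real x) within stolz_cone upper_halfplane x a)"
        using Lim_transform_eventually by blast
    qed
  qed
qed

text \<open>
  The membership in the spaces on the line asks for Borel functions, while an arbitrary boundary function is Borel only
  up to a null set.
\<close>
lemma borel_boundary_values:
  assumes hol: "F holomorphic_on upper_halfplane" and bv: "has_boundary_values upper_halfplane F f"
  obtains g where "g \<in> borel_measurable borel" "has_boundary_values upper_halfplane F g" "AE x in lborel. g x = f x"
proof
  let ?g = "\<lambda>x. lim (\<lambda>n. F (Complex x (1 / (real n + 1))))"
  have "(\<lambda>x. F (Complex x (1 / (real n + 1)))) \<in> borel_measurable borel" for n
    by (intro measurable_on_line[OF hol]) (simp add: upper_halfplane_def)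
  then show "?g \<in> borel_measurable borel" by measurable
  have \<eta>: "(\<lambda>n. 1 / (real n + 1)) \<longlonglongrightarrow> 0" by real_asymp
  have "AE x in lborel. (\<lambda>n. F (Complex x (1 / (real n + 1)))) \<longlonglongrightarrow> f x"
    by (intro boundary_values_vertical[OF bv _ \<eta>]) (auto simp: upper_halfplane_def add_nonneg_eq_0_iff)
  then show eq: "AE x in lborel. ?g x = f x"
    by eventually_elim (rule limI)
  show "has_boundary_values upper_halfplane F ?g"
    using bv eq unfolding has_boundary_values_def by eventually_elim simp
qed

text \<open>
  With \<open>b\<close> the boundary function of the series of difference quotients, \<open>f = t (cnj b)\<close> holds term by term because
  \<open>t (cnj t) = 1\<close>, and \<open>cnj b\<close> is the boundary function of a Hardy function in the lower half-plane by reflection.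
\<close>
lemma model_space_pole_series:
  assumes p: "1 < p" and \<theta>: "inner_function \<theta>" and l: "\<And>n. 0 < Im (l n)" "\<And>n. Im (l n) \<le> 1"
  obtains f where "f \<in> model_space p \<theta>"
    "(\<lambda>z. \<Sum>n. of_real (pole_weight p (l n) n) * ((1 - cnj (\<theta> (l n)) * \<theta> z) / (z - cnj (l n)))) \<in> hardy_fun p upper_halfplane"
    "has_boundary_values upper_halfplane (\<lambda>z. \<Sum>n. of_real (pole_weight p (l n) n) * ((1 - cnj (\<theta> (l n)) * \<theta> z) / (z - cnj (l n)))) f"
    "\<forall>z\<in>upper_halfplane. summable (\<lambda>n. of_real (pole_weight p (l n) n) * ((1 - cnj (\<theta> (l n)) * \<theta> z) / (z - cnj (l n))))"
proof -
  obtain s M where hol: "\<theta> holomorphic_on upper_halfplane" and M: "\<And>z. 0 < Im z \<Longrightarrow> norm (\<theta> z) \<le> M"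
    and s: "has_boundary_values upper_halfplane \<theta> s" "AE x in lborel. norm (s x) = 1"
    using \<theta> by (auto simp: inner_function_def hardy_inf_fun_def bounded_iff upper_halfplane_def)
  obtain t where [measurable]: "t \<in> borel_measurable borel" and t: "has_boundary_values upper_halfplane \<theta> t" and ts: "AE x in lborel. t x = s x"
    using borel_boundary_values[OF hol s(1)] by blast
  have M0: "0 \<le> M" using order_trans[OF norm_ge_zero M[of \<i>]] by simp
  \<comment> \<open>A strictly positive bound, so that the constants in the estimates of the terms are positive.\<close>
  define M' where "M' = M + 1"
  have M': "\<And>z. 0 < Im z \<Longrightarrow> norm (\<theta> z) \<le> M'" "0 < M'" using M M0 by (auto simp: M'_def intro: order_trans add_increasing2)
  let ?w = "\<lambda>n. complex_of_real (pole_weight p (l n) n)"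
  let ?uA = "\<lambda>n x. (1 - cnj (\<theta> (l n)) * t x) / (of_real x - cnj (l n))"
  let ?uB = "\<lambda>n x. (t x - \<theta> (l n)) / (of_real x - l n)"
  have mA: "?uA n \<in> borel_measurable borel" and mB: "?uB n \<in> borel_measurable borel" for n
    by measurable
  have C: "0 < 1 + M' * M'" "0 < 10 * M'" using M'(2) by (auto simp: add_pos_pos)
  define FA where "FA = (\<lambda>z. \<Sum>n. ?w n * ((1 - cnj (\<theta> (l n)) * \<theta> z) / (z - cnj (l n))))"
  define FB where "FB = (\<lambda>z. \<Sum>n. ?w n * difference_quotient \<theta> (l n) z)"
  define f where "f = (\<lambda>x. \<Sum>n. ?w n * ?uA n x)"
  define b where "b = (\<lambda>x. \<Sum>n. ?w n * ?uB n x)"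
  define g where "g = (\<lambda>x. cnj (b x))"
  note A = pole_series[where l = l, OF p l C(1) reproducing_kernel_term[OF hol M'(1) l(1) t] mA]
  note B = pole_series[where l = l, OF p l C(2) difference_quotient_term[OF hol M'(1) l(1) t] mB]
  have FA: "FA \<in> hardy_fun p upper_halfplane" "has_boundary_values upper_halfplane FA f" and fL: "f \<in> Lp_space p"
    unfolding FA_def f_def by - (rule A(1) A(3) A(2); assumption)+
  have summ: "summable (\<lambda>n. ?w n * ((1 - cnj (\<theta> (l n)) * \<theta> z) / (z - cnj (l n))))" if "0 < Im z" for z
    by (rule A(5)) (use that in auto)
  have FB: "FB \<in> hardy_fun p upper_halfplane" "has_boundary_values upper_halfplane FB b" and bL: "b \<in> Lp_space p"
    unfolding FB_def b_def by - (rule B(1) B(3) B(2); assumption)+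
  have bsum: "AE x in lborel. summable (\<lambda>n. ?w n * ?uB n x)" by (rule B(4))
  have "cnj \<in> borel_measurable borel" by (intro borel_measurable_continuous_onI continuous_intros)
  then have gL: "g \<in> Lp_space p"
    using bL by (auto simp: Lp_space_def g_def intro: measurable_compose[of b _ _ cnj])
  have gH: "g \<in> hardy_space p lower_halfplane"
    unfolding hardy_space_def using gL hardy_fun_reflect[OF FB(1)] boundary_values_reflect[OF FB(2)]
    by (auto simp: g_def)
  have "AE x in lborel. f x = t x * g x"
    using s(2) ts bsum
  proof eventually_elim
    case (elim x)
    have tt: "t x * cnj (t x) = 1" using elim(1,2) by (simp add: complex_norm_square[symmetric])
    have cs: "(\<lambda>n. cnj (?w n * ?uB n x)) sums cnj (b x)"
      unfolding b_def using elim(3) by (subst sums_cnj) (rule summable_sums)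
    then have "(\<lambda>n. t x * cnj (?w n * ?uB n x)) sums (t x * g x)"
      unfolding g_def by (rule sums_mult)
    moreover have "t x * cnj (?w n * ?uB n x) = ?w n * ?uA n x" for n
    proof -
      have "t x * cnj (t x - \<theta> (l n)) = 1 - cnj (\<theta> (l n)) * t x"
        by (simp add: tt algebra_simps)
      then show ?thesis by (simp add: mult.left_commute[of "t x"])
    qed
    ultimately have "(\<lambda>n. ?w n * ?uA n x) sums (t x * g x)" by (simp only:)
    then show ?case unfolding f_def by (rule sums_unique[symmetric])
  qed
  then have "f \<in> boundary_mult \<theta> (hardy_space p lower_halfplane)"
    using t gH fL by (auto simp: boundary_mult_def Lp_space_def)
  moreover have "f \<in> hardy_space p upper_halfplane"
    using fL FA by (auto simp: hardy_space_def)
  ultimately have "f \<in> model_space p \<theta>" by (simp add: model_space_def)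
  then show ?thesis using that FA summ by (simp add: FA_def upper_halfplane_def)
qed

section \<open>Boundedness implies a lower bound near the line\<close>

lemma norm_suminf_ge:
  fixes v :: "nat \<Rightarrow> complex"
  assumes v: "summable v" and r: "\<And>n. n \<noteq> m \<Longrightarrow> norm (v n) \<le> (1 / 4) ^ n * D" and D: "0 \<le> D"
  shows "norm (v m) - 2 * D \<le> norm (suminf v)"
proof -
  define r where "r = (\<lambda>n. if n = m then 0 else v n)"
  have le: "norm (r n) \<le> (1 / 4) ^ n * D" for n
    using assms(2)[of n] D by (auto simp: r_def)
  have geo: "(\<lambda>n. (1 / 4) ^ n * D) sums (4 / 3 * D)"
    using sums_mult2[OF geometric_sums[of "1 / 4 :: real"], of D] by simp
  have sn: "summable (\<lambda>n. norm (r n))"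
    using le by (intro summable_comparison_test'[OF sums_summable[OF geo], of 0]) auto
  have "norm (suminf r) \<le> (\<Sum>n. norm (r n))" by (rule summable_norm[OF sn])
  also have "\<dots> \<le> 4 / 3 * D"
    unfolding sums_unique[OF geo] by (rule suminf_le[OF le sn sums_summable[OF geo]])
  also have "\<dots> \<le> 2 * D" using D by simp
  finally have 1: "norm (suminf r) \<le> 2 * D" .
  have "(\<lambda>n. (if n = m then v n else 0) + r n) sums (v m + suminf r)"
    by (intro sums_add sums_single summable_sums summable_norm_cancel[OF sn])
  moreover have "(\<lambda>n. (if n = m then v n else 0) + r n) = v" by (auto simp: r_def)
  ultimately have "suminf v = v m + suminf r" by (simp add: sums_iff)
  then show ?thesis
    using 1 norm_triangle_ineq[of "v m + suminf r" "- suminf r"] by simp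
qed

text \<open>
  The last condition makes the weighted kernel at \<open>l (Suc n)\<close>, evaluated at its own point, exceed a bound for the sum of all other terms by \<open>n\<close>. The
  two before it keep the later terms within that bound. All of them hold once \<open>Im (l (Suc n))\<close> is small enough,
  since \<open>y powr (- 1/p)\<close> tends to infinity and \<open>y powr (1 - 1/p)\<close> to 0.
\<close>
lemma exists_rapidly_descending_points:
  assumes p: "1 < p" and c: "c < 1" "0 \<le> c" and C: "0 < C"
    and ex: "\<And>e. 0 < e \<Longrightarrow> \<exists>z. 0 < Im z \<and> Im z < e \<and> norm (\<theta> z) \<le> c"
  obtains l where "\<And>n. 0 < Im (l n)" "\<And>n. Im (l n) \<le> 1" "\<And>n. norm (\<theta> (l n)) \<le> c"
    "\<And>n. Im (l (Suc n)) \<le> Im (l n)" "\<And>n. Im (l (Suc n)) powr (1 - 1 / p) \<le> Im (l n)"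
    "\<And>n. (1 / 4) ^ Suc n * Im (l (Suc n)) powr (- 1 / p) * ((1 - c\<^sup>2) / 2)
        \<ge> real n + 2 * (C * (Im (l n) powr (- 1 / p) + 1))"
proof -
  have "c\<^sup>2 < 1" using c by (simp add: power_less_one_iff abs_square_less_1)
  then have c2: "0 < (1 - c\<^sup>2) / 2" by simp
  define Q where "Q = (\<lambda>n z w. Im w \<le> Im z \<and> Im w powr (1 - 1 / p) \<le> Im z \<and>
     (1 / 4) ^ Suc n * Im w powr (- 1 / p) * ((1 - c\<^sup>2) / 2) \<ge> real n + 2 * (C * (Im z powr (- 1 / p) + 1)))"
  have "\<exists>l. \<forall>n. (0 < Im (l n) \<and> Im (l n) \<le> 1 \<and> norm (\<theta> (l n)) \<le> c) \<and> Q n (l n) (l (Suc n))"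
  proof (rule dependent_nat_choice)
    show "\<exists>z. 0 < Im z \<and> Im z \<le> 1 \<and> norm (\<theta> z) \<le> c"
      using ex[of 1] by (auto intro: less_imp_le)
    fix z n assume z: "0 < Im z \<and> Im z \<le> 1 \<and> norm (\<theta> z) \<le> c"
    define R where "R = (real n + 2 * (C * (Im z powr (- 1 / p) + 1))) / ((1 / 4) ^ Suc n * ((1 - c\<^sup>2) / 2))"
    have "\<forall>\<^sub>F y in at_right 0. y < Im z"
      using z by (auto simp: eventually_at_right_field)
    moreover have "\<forall>\<^sub>F y in at_right 0. y powr (1 - 1 / p) < Im z"
    proof (rule order_tendstoD(2))
      show "((\<lambda>y. y powr (1 - 1 / p)) \<longlongrightarrow> 0) (at_right 0)"
        using p by real_asymp
    qed (use z in auto)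
    moreover have "\<forall>\<^sub>F y in at_right 0. R \<le> y powr (- 1 / p)"
    proof -
      have "filterlim (\<lambda>y. y powr (- 1 / p)) at_top (at_right 0)" using p by real_asymp
      then show ?thesis by (simp add: filterlim_at_top)
    qed
    ultimately have "\<forall>\<^sub>F y in at_right 0. y < Im z \<and> y powr (1 - 1 / p) < Im z \<and> R \<le> y powr (- 1 / p)"
      by eventually_elim auto
    then obtain e where e: "0 < e" "\<And>y. 0 < y \<Longrightarrow> y < e \<Longrightarrow> y < Im z \<and> y powr (1 - 1 / p) < Im z \<and> R \<le> y powr (- 1 / p)"
      by (auto simp: eventually_at_right_field)
    obtain w where w: "0 < Im w" "Im w < e" "norm (\<theta> w) \<le> c" using ex[OF e(1)] by blast
    have "R * ((1 / 4) ^ Suc n * ((1 - c\<^sup>2) / 2)) \<le> Im w powr (- 1 / p) * ((1 / 4) ^ Suc n * ((1 - c\<^sup>2) / 2))"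
      using e(2)[OF w(1,2)] c2 by (intro mult_right_mono) auto
    moreover have "R * ((1 / 4) ^ Suc n * ((1 - c\<^sup>2) / 2)) = real n + 2 * (C * (Im z powr (- 1 / p) + 1))"
    proof -
      have *: "u / v * v = u" if "v \<noteq> 0" for u v :: real using that by simp
      show ?thesis unfolding R_def by (rule *) (use c2 in simp)
    qed
    ultimately have "Q n z w"
      using e(2)[OF w(1,2)] unfolding Q_def by (simp add: mult_ac)
    then show "\<exists>w. (0 < Im w \<and> Im w \<le> 1 \<and> norm (\<theta> w) \<le> c) \<and> Q n z w"
      using w z by (intro exI[of _ w]) (auto simp: Q_def intro: order_trans)
  qed
  then show ?thesis using that unfolding Q_def by blast
qed

text \<open>
  The gliding hump, at \<open>l m\<close> with \<open>m = Suc k\<close>. In an earlier term the distance to the pole is at least \<open>Im (l n)\<close>, in a later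
  one at least \<open>Im (l m)\<close>, which dominates the normalising power of \<open>Im (l n)\<close>. So \<open>D\<close> bounds
  all other terms up to the factor \<open>4\<^sup>-\<^sup>n\<close>, and the term with index \<open>m\<close> prevails.
\<close>
lemma unbounded_pole_series:
  fixes \<theta> :: "complex \<Rightarrow> complex"
  assumes p: "1 < p" and c: "c < 1" "0 \<le> c" and M: "\<And>z. 0 < Im z \<Longrightarrow> norm (\<theta> z) \<le> M" "0 \<le> M"
    and l: "\<And>n. 0 < Im (l n)" "\<And>n. norm (\<theta> (l n)) \<le> c"
    and mono: "\<And>n. Im (l (Suc n)) \<le> Im (l n)" "\<And>n. Im (l (Suc n)) powr (1 - 1 / p) \<le> Im (l n)"
    and grow: "\<And>n. (1 / 4) ^ Suc n * Im (l (Suc n)) powr (- 1 / p) * ((1 - c\<^sup>2) / 2)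
        \<ge> real n + 2 * ((1 + M * M) * (Im (l n) powr (- 1 / p) + 1))"
    and summ: "\<And>z. 0 < Im z \<Longrightarrow>
      summable (\<lambda>n. of_real (pole_weight p (l n) n) * ((1 - cnj (\<theta> (l n)) * \<theta> z) / (z - cnj (l n))))"
  shows "real k \<le> norm (\<Sum>n. of_real (pole_weight p (l n) n) *
      ((1 - cnj (\<theta> (l n)) * \<theta> (l (Suc k))) / (l (Suc k) - cnj (l n))))"
proof -
  define m where "m = Suc k"
  define y where "y = (\<lambda>n. Im (l n))"
  define C where "C = 1 + M * M"
  have C: "0 < C" using M(2) by (simp add: C_def add_pos_nonneg)
  have y: "0 < y n" for n using l by (simp add: y_def)
  have anti: "antimono y" unfolding y_def by (rule antimonoI[OF lift_Suc_antimono_le]) (use mono in auto)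
  define v where "v = (\<lambda>n. complex_of_real (pole_weight p (l n) n) * ((1 - cnj (\<theta> (l n)) * \<theta> (l m)) / (l m - cnj (l n))))"
  have split: "y n powr (1 - 1 / p) / y n = y n powr (- 1 / p)" for n
  proof -
    have "y n powr (1 - 1 / p) / y n powr 1 = y n powr (- 1 / p)"
      by (subst powr_diff[symmetric]) simp
    then show ?thesis using y[of n] by simp
  qed
  define D where "D = C * (y k powr (- 1 / p) + 1)"
  have D: "0 \<le> D" using C by (simp add: D_def)
  have other: "norm (v n) \<le> (1 / 4) ^ n * D" if "n \<noteq> m" for n
  proof -
    have num: "norm (1 - cnj (\<theta> (l n)) * \<theta> (l m)) \<le> C"
    proof -
      have "norm (1 - cnj (\<theta> (l n)) * \<theta> (l m)) \<le> 1 + norm (\<theta> (l n)) * norm (\<theta> (l m))"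
        using norm_triangle_ineq4[of 1 "cnj (\<theta> (l n)) * \<theta> (l m)"] by (simp add: norm_mult)
      also have "\<dots> \<le> 1 + M * M"
        using M l by (intro add_left_mono mult_mono) auto
      finally show ?thesis by (simp add: C_def)
    qed
    have dd: "0 < norm (l m - cnj (l n))" using l(1)[of n] l(1)[of m] by (auto simp: complex_eq_iff)
    have "y n powr (1 - 1 / p) / norm (l m - cnj (l n)) \<le> y k powr (- 1 / p) + 1"
    proof (cases "n < m")
      case True
      then have "y k \<le> y n" using anti by (auto simp: m_def antimono_def)
      have "y n powr (1 - 1 / p) / norm (l m - cnj (l n)) \<le> y n powr (1 - 1 / p) / y n"
        using dist_pole_ge(2)[of "l n" "l m"] l(1) y[of n] dd unfolding y_def by (intro divide_left_mono mult_pos_pos) auto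
      also have "\<dots> = y n powr (- 1 / p)" by (rule split)
      also have "\<dots> \<le> y k powr (- 1 / p)"
        using \<open>y k \<le> y n\<close> y[of k] p by (intro powr_mono2') auto
      finally show ?thesis by simp
    next
      case False
      with that obtain j where j: "n = Suc j" "m \<le> j" by (cases n) auto
      have "y n powr (1 - 1 / p) \<le> y j" using mono(2)[of j] by (simp add: y_def j)
      also have "\<dots> \<le> y m" using anti j by (auto simp: antimono_def)
      also have "\<dots> \<le> norm (l m - cnj (l n))" using dist_pole_ge(1)[of "l n" "l m"] l(1) by (simp add: y_def)
      finally have "y n powr (1 - 1 / p) / norm (l m - cnj (l n)) \<le> 1" using dd by simp
      then show ?thesis by (rule order_trans) simp
    qed
    then have "C * (y n powr (1 - 1 / p) / norm (l m - cnj (l n))) \<le> D"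
      unfolding D_def using C by (intro mult_left_mono) auto
    moreover have "norm (v n) \<le> (1 / 4) ^ n * (C * (y n powr (1 - 1 / p) / norm (l m - cnj (l n))))"
    proof -
      have "norm (v n) = (1 / 4) ^ n * (norm (1 - cnj (\<theta> (l n)) * \<theta> (l m)) * (y n powr (1 - 1 / p) / norm (l m - cnj (l n))))"
        by (simp add: v_def norm_mult norm_divide norm_power pole_weight_def y_def)
      also have "\<dots> \<le> (1 / 4) ^ n * (C * (y n powr (1 - 1 / p) / norm (l m - cnj (l n))))"
        using num by (intro mult_left_mono mult_right_mono) auto
      finally show ?thesis .
    qed
    ultimately show ?thesis
      using mult_left_mono[of "C * (y n powr (1 - 1 / p) / norm (l m - cnj (l n)))" D "(1 / 4) ^ n"] by simp
  qed
  have main: "(1 / 4) ^ m * y m powr (- 1 / p) * ((1 - c\<^sup>2) / 2) \<le> norm (v m)"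
  proof -
    have e1: "1 - cnj (\<theta> (l m)) * \<theta> (l m) = of_real (1 - (norm (\<theta> (l m)))\<^sup>2)"
      by (simp only: of_real_diff of_real_1 complex_norm_square mult.commute[of "cnj _"])
    have e2: "norm (l m - cnj (l m)) = 2 * y m"
      using l(1)[of m] by (simp add: complex_diff_cnj norm_mult y_def)
    have "(norm (\<theta> (l m)))\<^sup>2 \<le> c\<^sup>2" using l(2) by (intro power_mono) auto
    then have 1: "1 - c\<^sup>2 \<le> norm (1 - cnj (\<theta> (l m)) * \<theta> (l m))"
      unfolding e1 norm_of_real by linarith
    have "(1 / 4) ^ m * y m powr (- 1 / p) * ((1 - c\<^sup>2) / 2) = (1 / 4) ^ m * y m powr (1 - 1 / p) * ((1 - c\<^sup>2) / (2 * y m))"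
      unfolding split[symmetric] by simp
    also have "\<dots> \<le> (1 / 4) ^ m * y m powr (1 - 1 / p) * (norm (1 - cnj (\<theta> (l m)) * \<theta> (l m)) / (2 * y m))"
      using 1 y[of m] by (intro mult_left_mono divide_right_mono) auto
    also have "\<dots> = norm (v m)"
      by (simp add: v_def norm_mult norm_divide norm_power pole_weight_def e2 y_def)
    finally show ?thesis .
  qed
  have "real k + 2 * D \<le> norm (v m)"
    using main grow[of k] by (simp add: D_def C_def y_def m_def)
  moreover have "norm (v m) - 2 * D \<le> norm (suminf v)"
    using summ[OF l(1)[of m]] other D by (intro norm_suminf_ge) (simp_all add: v_def)
  ultimately show ?thesis by (simp add: v_def m_def)
qed

lemma lower_bound_if_model_space_subset:
  assumes p: "1 < p" and \<theta>: "inner_function \<theta>" and sub: "model_space p \<theta> \<subseteq> hardy_inf_space upper_halfplane"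
    and c: "c < 1"
  shows "\<exists>\<epsilon>>0. \<forall>z. 0 < Im z \<longrightarrow> Im z < \<epsilon> \<longrightarrow> c < norm (\<theta> z)"
proof (rule ccontr)
  assume contra: "\<not> ?thesis"
  have ex: "\<exists>z. 0 < Im z \<and> Im z < e \<and> norm (\<theta> z) \<le> c" if "0 < e" for e
  proof -
    have "\<not> (\<forall>z. 0 < Im z \<longrightarrow> Im z < e \<longrightarrow> c < norm (\<theta> z))" using contra that by blast
    then show ?thesis by (auto simp: not_less)
  qed
  obtain z0 where "norm (\<theta> z0) \<le> c" using ex[of 1] by auto
  then have c0: "0 \<le> c" using norm_ge_zero by (rule order_trans[rotated])
  obtain M where hol: "\<theta> holomorphic_on upper_halfplane" and M: "\<And>z. 0 < Im z \<Longrightarrow> norm (\<theta> z) \<le> M"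
    using \<theta> by (auto simp: inner_function_def hardy_inf_fun_def bounded_iff upper_halfplane_def)
  have M0: "0 \<le> M" using order_trans[OF norm_ge_zero M[of \<i>]] by simp
  have C: "0 < 1 + M * M" using M0 by (simp add: add_pos_nonneg)
  obtain l where l: "\<And>n. 0 < Im (l n)" "\<And>n. Im (l n) \<le> 1" "\<And>n. norm (\<theta> (l n)) \<le> c"
    and mono: "\<And>n. Im (l (Suc n)) \<le> Im (l n)" "\<And>n. Im (l (Suc n)) powr (1 - 1 / p) \<le> Im (l n)"
    and grow: "\<And>n. (1 / 4) ^ Suc n * Im (l (Suc n)) powr (- 1 / p) * ((1 - c\<^sup>2) / 2)
        \<ge> real n + 2 * ((1 + M * M) * (Im (l n) powr (- 1 / p) + 1))"
    using exists_rapidly_descending_points[OF p c c0 C ex] by blast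
  define F where "F = (\<lambda>z. \<Sum>n. of_real (pole_weight p (l n) n) * ((1 - cnj (\<theta> (l n)) * \<theta> z) / (z - cnj (l n))))"
  obtain f where f: "f \<in> model_space p \<theta>" "F \<in> hardy_fun p upper_halfplane" "has_boundary_values upper_halfplane F f"
    and summ: "\<forall>z\<in>upper_halfplane.
      summable (\<lambda>n. of_real (pole_weight p (l n) n) * ((1 - cnj (\<theta> (l n)) * \<theta> z) / (z - cnj (l n))))"
    unfolding F_def by (rule model_space_pole_series[where l = l, OF p \<theta> l(1,2)])
  obtain G where G: "G \<in> hardy_inf_fun upper_halfplane" "has_boundary_values upper_halfplane G f"
    using f(1) sub by (auto simp: hardy_inf_space_def)
  obtain K where K: "\<And>z. z \<in> upper_halfplane \<Longrightarrow> norm (G z) \<le> K"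
    using G(1) by (auto simp: hardy_inf_fun_def bounded_iff)
  have "real k \<le> K" for k
  proof -
    have "real k \<le> norm (F (l (Suc k)))"
      unfolding F_def
    proof (rule unbounded_pole_series[where l = l and \<theta> = \<theta>, OF p c c0 M M0 l(1,3) mono grow])
      show "summable (\<lambda>n. of_real (pole_weight p (l n) n) * ((1 - cnj (\<theta> (l n)) * \<theta> z) / (z - cnj (l n))))"
        if "0 < Im z" for z
        using summ that by (simp add: upper_halfplane_def)
    qed
    also have "F (l (Suc k)) = G (l (Suc k))"
      using hardy_eq_if_boundary_values_eq[OF p f(2) G(1) f(3) G(2)] l(1) by (simp add: upper_halfplane_def)
    also have "norm (G (l (Suc k))) \<le> K" using K l(1) by (simp add: upper_halfplane_def)
    finally show ?thesis .
  qed
  then show False using reals_Archimedean2[of K] not_le by blast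
qed

text \<open>
  At almost every point of the line the vertical limit of \<open>|\<theta>|\<close> is 1, and one such point suffices.
\<close>
lemma Inf_strip_le_1:
  assumes \<theta>: "inner_function \<theta>" and \<epsilon>: "0 < \<epsilon>"
  shows "(INF z\<in>{z. 0 < Im z \<and> Im z < \<epsilon>}. norm (\<theta> z)) \<le> 1"
proof -
  obtain t where t: "has_boundary_values upper_halfplane \<theta> t" "AE x in lborel. norm (t x) = 1"
    using \<theta> by (auto simp: inner_function_def)
  define \<eta> where "\<eta> = (\<lambda>n. \<epsilon> / (real n + 2))"
  have \<eta>: "0 < \<eta> n" "\<eta> n < \<epsilon>" for n
  proof -
    show "0 < \<eta> n" using \<epsilon> by (simp add: \<eta>_def)
    have "\<epsilon> * 1 < \<epsilon> * (real n + 2)" using \<epsilon> by (intro mult_strict_left_mono) auto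
    then show "\<eta> n < \<epsilon>" by (simp add: \<eta>_def divide_less_eq)
  qed
  have \<eta>0: "\<eta> \<longlonglongrightarrow> 0" unfolding \<eta>_def by real_asymp
  have "AE x in lborel. (\<lambda>n. \<theta> (Complex x (\<eta> n))) \<longlonglongrightarrow> t x"
    using \<eta> by (intro boundary_values_vertical[OF t(1) _ \<eta>0]) (auto simp: upper_halfplane_def less_imp_neq[THEN not_sym])
  with t(2) have "AE x in lborel. (\<lambda>n. norm (\<theta> (Complex x (\<eta> n)))) \<longlonglongrightarrow> 1"
  proof eventually_elim
    case (elim x)
    show ?case using tendsto_norm[OF elim(2)] elim(1) by simp
  qed
  moreover have "ae_filter (lborel :: real measure) \<noteq> bot"
    by (simp add: ae_filter_eq_bot_iff)
  ultimately obtain x where x: "(\<lambda>n. norm (\<theta> (Complex x (\<eta> n)))) \<longlonglongrightarrow> 1"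
    using eventually_happens' by blast
  show ?thesis
  proof (rule tendsto_lowerbound[OF x])
    have "bdd_below ((\<lambda>z. norm (\<theta> z)) ` {z. 0 < Im z \<and> Im z < \<epsilon>})"
      by (intro bdd_belowI[of _ 0]) auto
    then show "\<forall>\<^sub>F n in sequentially. (INF z\<in>{z. 0 < Im z \<and> Im z < \<epsilon>}. norm (\<theta> z)) \<le> norm (\<theta> (Complex x (\<eta> n)))"
      using \<eta> by (intro always_eventually allI cINF_lower) auto
  qed simp
qed

theorem corollary4p4:
  fixes p :: real and \<theta> :: "complex \<Rightarrow> complex"
  assumes "1 < p" and "inner_function \<theta>"
  shows "model_space p \<theta> \<subseteq> hardy_inf_space upper_halfplane \<longleftrightarrow>
    ((\<lambda>\<epsilon>::real. INF z\<in>{z. 0 < Im z \<and> Im z < \<epsilon>}. norm (\<theta> z)) \<longlongrightarrow> 1) (at_right 0)"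
proof
  let ?I = "\<lambda>\<epsilon>::real. INF z\<in>{z. 0 < Im z \<and> Im z < \<epsilon>}. norm (\<theta> z)"
  assume sub: "model_space p \<theta> \<subseteq> hardy_inf_space upper_halfplane"
  show "(?I \<longlongrightarrow> 1) (at_right 0)"
  proof (rule order_tendstoI)
    fix a :: real assume "a < 1"
    then obtain c where c: "a < c" "c < 1" using dense by blast
    obtain \<epsilon> where \<epsilon>: "0 < \<epsilon>" "\<And>z. 0 < Im z \<Longrightarrow> Im z < \<epsilon> \<Longrightarrow> c < norm (\<theta> z)"
      using lower_bound_if_model_space_subset[OF assms sub c(2)] by blast
    have "a < ?I e" if "0 < e" "e < \<epsilon>" for e
    proof -
      have "Complex 0 (e / 2) \<in> {z. 0 < Im z \<and> Im z < e}" using that by simp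
      then have "{z. 0 < Im z \<and> Im z < e} \<noteq> {}" by blast
      then have "c \<le> ?I e"
        using \<epsilon>(2) that by (intro cINF_greatest) (auto intro: less_imp_le)
      then show ?thesis using c by simp
    qed
    then show "\<forall>\<^sub>F e in at_right 0. a < ?I e"
      using \<epsilon>(1) by (auto simp: eventually_at_right_field)
  next
    fix a :: real assume "1 < a"
    then show "\<forall>\<^sub>F e in at_right 0. ?I e < a"
      using Inf_strip_le_1[OF assms(2)]
      by (auto simp: eventually_at_right_field intro!: exI[of _ 1] intro: le_less_trans)
  qed
next
  let ?I = "\<lambda>\<epsilon>::real. INF z\<in>{z. 0 < Im z \<and> Im z < \<epsilon>}. norm (\<theta> z)"
  assume "(?I \<longlongrightarrow> 1) (at_right 0)"
  then have "\<forall>\<^sub>F e in at_right 0. 1 / 2 < ?I e" by (rule order_tendstoD) simp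
  then obtain b where b: "0 < b" "\<And>e. 0 < e \<Longrightarrow> e < b \<Longrightarrow> 1 / 2 < ?I e"
    by (auto simp: eventually_at_right_field)
  have bdd: "bdd_below ((\<lambda>z. norm (\<theta> z)) ` {z. 0 < Im z \<and> Im z < b / 2})"
    by (intro bdd_belowI[of _ 0]) auto
  show "model_space p \<theta> \<subseteq> hardy_inf_space upper_halfplane"
  proof (rule model_space_subset_if_lower_bound[OF assms])
    show "1 / 2 \<le> norm (\<theta> z)" if "0 < Im z" "Im z < b / 2" for z
      using cINF_lower[OF bdd, of z] b(2)[of "b / 2"] that by simp
  qed (use b in auto)
qed

end
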